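(* For every integer $n \ge 1$, $\mathsf{Opt}(F_n) = \mathsf{RePair}(F_n)$. That is, every grammar of $F_n$ produced by any implementation of RePair is a smallest grammar of $F_n$, and every smallest grammar of $F_n$ is (up to equivalence) produced by some implementation of RePair.
   Context: Fibonacci words over $\{\mathtt{a},\mathtt{b}\}$: $F_1=\mathtt{b}$, $F_2=\mathtt{a}$, $F_i=F_{i-1}F_{i-2}$ for $i\ge 3$. A grammar of a string $w$ is a straight-line program (SLP): a context-free grammar in Chomsky normal form deriving exactly $w$, with productions $X_i\to\alpha$ ($\alpha$ a terminal) or $X_i\to X_jX_k$ with $j,k<i$. Its size $|G|$ is the number of productions. Two grammars deriving the same string are equivalent if there is a bijective renaming of non-terminals transforming the derivation tree of one into that of the other; sets of grammars are taken up to this equivalence (one representative per class). $\mathsf{Opt}(w)$ is the set of all grammars of $w$ of minimum size. RePair on $w$: (1) replace each terminal by a non-terminal (creating unary productions); (2) repeatedly choose an arbitrary bigram having the maximum number of non-overlapping occurrences in the current string and replace all possible (non-overlapping, left-to-right) occurrences of it by a fresh non-terminal $X$, adding the production $X\to$ (that bigram), until no bigram has two or more non-overlapping occurrences; (3) combine the remaining sequence of non-terminals by binary productions into a single start symbol. Different choices among tied most frequent bigrams (and in the final combination) give different grammars; $\mathsf{RePair}(w)$ is the set of all grammars obtainable this way. *)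

theory Defs
  imports Main
begin

datatype letter = La | Lb

text \<open>The sequence of Fibonacci words starts at index 1; the value at index 0 is a dummy.\<close>

fun fib_word :: "nat \<Rightarrow> letter list" where
  "fib_word 0 = []"
| "fib_word (Suc 0) = [Lb]"
| "fib_word (Suc (Suc 0)) = [La]"
| "fib_word (Suc (Suc (Suc n))) = fib_word (Suc (Suc n)) @ fib_word (Suc n)"


section \<open>Straight-line programs\<close>

text \<open>
  A straight-line program is the list of the right-hand sides of its productions. The
  non-terminals are the positions of the list, each having exactly one production, and the
  start symbol is the last one. The size is the length of the list.
\<close>

datatype 't rhs = Term 't | Bin nat nat

type_synonym 't slp = "'t rhs list"

definition wf_slp :: "'t slp \<Rightarrow> bool" where
  "wf_slp G \<longleftrightarrow> G \<noteq> [] \<and> (\<forall>i < length G. \<forall>j k. G ! i = Bin j k \<longrightarrow> j < i \<and> k < i)"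

definition start :: "'t slp \<Rightarrow> nat" where
  "start G = length G - 1"

datatype ('n, 't) dtree = Leaf 'n 't | Node 'n "('n, 't) dtree" "('n, 't) dtree"

fun yield :: "('n, 't) dtree \<Rightarrow> 't list" where
  "yield (Leaf _ c) = [c]"
| "yield (Node _ l r) = yield l @ yield r"

inductive derivation :: "'t slp \<Rightarrow> nat \<Rightarrow> (nat, 't) dtree \<Rightarrow> bool" for G where
  Leaf: "i < length G \<Longrightarrow> G ! i = Term c \<Longrightarrow> derivation G i (Leaf i c)"
| Node: "i < length G \<Longrightarrow> G ! i = Bin j k \<Longrightarrow> derivation G j l \<Longrightarrow> derivation G k r
          \<Longrightarrow> derivation G i (Node i l r)"

definition grammar_of :: "'t list \<Rightarrow> 't slp \<Rightarrow> bool" where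
  "grammar_of w G \<longleftrightarrow> wf_slp G \<and> (\<exists>t. derivation G (start G) t \<and> yield t = w)"

text \<open>
  The renaming is a bijection between all non-terminals, also those that do not occur in the
  derivation tree. Equivalent grammars therefore have the same size.
\<close>

definition grammar_equiv :: "'t list \<Rightarrow> 't slp rel" where
  "grammar_equiv w = {(G, H). grammar_of w G \<and> grammar_of w H \<and>
     (\<exists>f t. bij_betw f {..<length G} {..<length H} \<and>
            derivation G (start G) t \<and> derivation H (start H) (map_dtree f id t))}"

lemma derivation_unique:
  "derivation G i t \<Longrightarrow> derivation G i u \<Longrightarrow> t = u"
proof (induction arbitrary: u rule: derivation.induct)
  case (Leaf i c)
  from Leaf(3) show ?case by cases (simp_all add: Leaf(2))
next
  case (Node i j k l r)
  from Node(7) show ?case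
  proof cases
    case (Node j' k' l' r')
    with Node.hyps(2) have "j' = j" "k' = k" by simp_all
    with Node have "l = l'" "r = r'" using Node.IH by blast+
    with Node show ?thesis by simp
  qed (simp add: Node.hyps(2))
qed

lemma derivation_labels: "derivation G i t \<Longrightarrow> set1_dtree t \<subseteq> {..<length G}"
  by (induction rule: derivation.induct) auto

lemma grammar_equivI:
  assumes "grammar_of w G" "grammar_of w H" "bij_betw f {..<length G} {..<length H}"
    and "derivation G (start G) t" "derivation H (start H) (map_dtree f id t)"
  shows "(G, H) \<in> grammar_equiv w"
  unfolding grammar_equiv_def mem_Collect_eq prod.case using assms by (intro conjI exI)

lemma equiv_grammar_equiv: "equiv {G. grammar_of w G} (grammar_equiv w)"
proof (rule equivI)
  show "grammar_equiv w \<subseteq> {G. grammar_of w G} \<times> {G. grammar_of w G}"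
    by (auto simp: grammar_equiv_def)
  show "refl_on {G. grammar_of w G} (grammar_equiv w)"
  proof (rule refl_onI)
    fix G assume "G \<in> {G. grammar_of w G}"
    then obtain t where "grammar_of w G" "derivation G (start G) t"
      by (auto simp: grammar_of_def)
    then show "(G, G) \<in> grammar_equiv w"
      by (intro grammar_equivI[where f = id and t = t]) (simp_all add: dtree.map_id0)
  qed
  show "sym (grammar_equiv w)"
  proof (rule symI)
    fix G H assume "(G, H) \<in> grammar_equiv w"
    then obtain f t where *: "grammar_of w G" "grammar_of w H"
      "bij_betw f {..<length G} {..<length H}" "derivation G (start G) t"
      "derivation H (start H) (map_dtree f id t)"
      by (auto simp: grammar_equiv_def)
    let ?g = "inv_into {..<length G} f"
    have "map_dtree ?g id (map_dtree f id t) = map_dtree id id t"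
      unfolding dtree.map_comp
    proof (rule dtree.map_cong[OF refl])
      fix i assume "i \<in> set1_dtree t"
      then show "(?g \<circ> f) i = id i"
        using derivation_labels[OF *(4)] *(3) by (auto simp: bij_betw_def subset_iff)
    qed simp
    then have "derivation G (start G) (map_dtree ?g id (map_dtree f id t))"
      using *(4) by (simp add: dtree.map_id0)
    then show "(H, G) \<in> grammar_equiv w"
      by (rule grammar_equivI[OF *(2) *(1) bij_betw_inv_into[OF *(3)] *(5)])
  qed
  show "trans (grammar_equiv w)"
  proof (rule transI)
    fix G H K assume "(G, H) \<in> grammar_equiv w" "(H, K) \<in> grammar_equiv w"
    then obtain f t g u where *: "grammar_of w G" "grammar_of w K"
      "bij_betw f {..<length G} {..<length H}" "derivation G (start G) t"
      "derivation H (start H) (map_dtree f id t)"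
      "bij_betw g {..<length H} {..<length K}" "derivation H (start H) u"
      "derivation K (start K) (map_dtree g id u)"
      by (auto simp: grammar_equiv_def)
    have "u = map_dtree f id t"
      using derivation_unique[OF *(7) *(5)] .
    then have "derivation K (start K) (map_dtree (g \<circ> f) id t)"
      using *(8) by (simp add: dtree.map_comp)
    then show "(G, K) \<in> grammar_equiv w"
      by (rule grammar_equivI[OF *(1) *(2) bij_betw_trans[OF *(3) *(6)] *(4)])
  qed
qed

definition Opt :: "'t list \<Rightarrow> 't slp set set" where
  "Opt w = {G. is_arg_min length (grammar_of w) G} // grammar_equiv w"


section \<open>RePair\<close>

definition bigram_occs :: "'n list \<Rightarrow> 'n \<Rightarrow> 'n \<Rightarrow> nat set" where
  "bigram_occs s x y = {i. Suc i < length s \<and> s ! i = x \<and> s ! Suc i = y}"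

text \<open>Two distinct occurrences of a bigram overlap iff their positions are consecutive.\<close>

definition bigram_freq :: "'n list \<Rightarrow> 'n \<Rightarrow> 'n \<Rightarrow> nat" where
  "bigram_freq s x y =
     Max (card ` {S. S \<subseteq> bigram_occs s x y \<and> (\<forall>i\<in>S. Suc i \<notin> S)})"

fun replace_bigram :: "'n \<Rightarrow> 'n \<Rightarrow> 'n \<Rightarrow> 'n list \<Rightarrow> 'n list" where
  "replace_bigram x y z (u # v # s) =
     (if u = x \<and> v = y then z # replace_bigram x y z s else u # replace_bigram x y z (v # s))"
| "replace_bigram x y z s = s"

text \<open>
  A state of RePair consists of the productions created so far and the current sequence of
  non-terminals. Appending a production to \<open>G\<close> creates the fresh non-terminal \<open>length G\<close>.
\<close>

type_synonym 't repair_state = "'t slp \<times> nat list"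

inductive repair_init :: "'t list \<Rightarrow> 't repair_state \<Rightarrow> bool" where
  "distinct cs \<Longrightarrow> set s = {..<length cs} \<Longrightarrow> map ((!) cs) s = w
    \<Longrightarrow> repair_init w (map Term cs, s)"

inductive repair_step :: "'t repair_state \<Rightarrow> 't repair_state \<Rightarrow> bool" where
  "bigram_freq s x y \<ge> 2 \<Longrightarrow> (\<And>x' y'. bigram_freq s x' y' \<le> bigram_freq s x y)
    \<Longrightarrow> repair_step (G, s) (G @ [Bin x y], replace_bigram x y (length G) s)"

inductive combine_step :: "'t repair_state \<Rightarrow> 't repair_state \<Rightarrow> bool" where
  "combine_step (G, s1 @ x # y # s2) (G @ [Bin x y], s1 @ length G # s2)"

text \<open>
  The remaining symbol \<open>x\<close> is always the last non-terminal of \<open>G\<close>: either the word is a single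
  letter and \<open>G\<close> has a single production, or \<open>x\<close> is created by the last combination. (A
  replacement step leaves at least two symbols.)
\<close>

definition repair_output :: "'t list \<Rightarrow> 't slp \<Rightarrow> bool" where
  "repair_output w G \<longleftrightarrow>
     (\<exists>\<sigma>0 G1 s1 x. repair_init w \<sigma>0 \<and> repair_step\<^sup>*\<^sup>* \<sigma>0 (G1, s1) \<and>
        (\<forall>x y. bigram_freq s1 x y < 2) \<and> combine_step\<^sup>*\<^sup>* (G1, s1) (G, [x]))"

definition RePair :: "'t list \<Rightarrow> 't slp set set" where
  "RePair w = {G. repair_output w G} // grammar_equiv w"

end

theory Submission
  imports Defs "HOL-Library.Sublist"
begin

text \<open>
  In the derivation tree of a grammar, every non-terminal with a binary rule splits its leftmost
  occurrence at some position of the word. A factor of length at least two without an earlier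
  occurrence must contain such a split point, because otherwise it would lie inside a repeated
  occurrence of a non-terminal. For \<open>F\<^sub>n\<close> this yields \<open>n - 2\<close> disjoint windows of positions, hence
  the lower bound \<open>n\<close> on the size. In a grammar of size \<open>n\<close> every window contains exactly one split
  point, which leaves so few adjacent split points that the letter \<open>Lb\<close> occurs in the right-hand
  side of a single rule, and this rule is \<open>La Lb\<close> or \<open>Lb La\<close>. Contracting it decodes the word by
  one of two substitutions, into the previous Fibonacci word or into a rotation of it, a
  Christoffel word, for which the same argument works. These contractions are exactly the steps
  of RePair, and only words of length two or three are left at the end.
\<close>

section \<open>Fibonacci and Christoffel words\<close>

text \<open>The windows are the intervals of \<open>rank\<close>. They partition all inner positions
  of the word, so in the extremal case no split point lies outside them, and two adjacent split
  points must straddle a border between two windows. If a rule has the leaf \<open>Lb\<close> as a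
  child, that \<open>Lb\<close> in its leftmost occurrence is cut off by two adjacent split points,
  or by one and an end of the word. Sharper factors keep the split point of a window away from one
  of its borders, which leaves a single place near the beginning of the word for such an
  \<open>Lb\<close>. For Fibonacci words one family of factors is enough; for Christoffel words the
  border that can be excluded depends on the parity of the index, hence the separate even and odd
  lemmas. Christoffel words arise when a Fibonacci word ends in \<open>Lb La\<close>: then
  \<open>Lb La\<close> is as frequent as \<open>La Lb\<close>, and replacing it gives a Christoffel
  word of the previous index. Such a word has \<open>Lb\<close> at exactly one end, so from then on
  only one bigram is most frequent. A contraction removes one rule and lowers the index by one, so
  the extremal count survives and the argument repeats.\<close>

fun phi :: "letter list \<Rightarrow> letter list" where
  "phi [] = []"
| "phi (La # w) = La # Lb # phi w"
| "phi (Lb # w) = La # phi w"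

fun psi :: "letter list \<Rightarrow> letter list" where
  "psi [] = []"
| "psi (La # w) = Lb # La # psi w"
| "psi (Lb # w) = La # psi w"

lemma phi_append: "phi (u @ v) = phi u @ phi v"
  by (induction u rule: phi.induct) auto

lemma psi_append: "psi (u @ v) = psi u @ psi v"
  by (induction u rule: psi.induct) auto

text \<open>Moving the \<open>La\<close> at the front of every block to its end turns one
  substitution into the other. Through this conjugation, facts about \<open>phi\<close> carry over
  to \<open>psi\<close>.\<close>

lemma phi_psi: "phi w @ [La] = La # psi w"
  by (induction w rule: phi.induct) auto

lemma phi_hd: "phi w = [] \<or> hd (phi w) = La"
  by (cases w rule: phi.cases) auto

lemma phi_not_Lb: "phi w \<noteq> Lb # v"
  using phi_hd[of w] by auto

lemma phi_inj: "phi u = phi v \<Longrightarrow> u = v"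
proof (induction u arbitrary: v rule: phi.induct)
  case 1
  then show ?case by (cases v rule: phi.cases) auto
next
  case (2 w)
  then show ?case by (cases v rule: phi.cases) (auto simp: phi_not_Lb phi_not_Lb[symmetric])
next
  case (3 w)
  then show ?case by (cases v rule: phi.cases) (auto simp: phi_not_Lb phi_not_Lb[symmetric])
qed

lemma psi_inj: "psi u = psi v \<Longrightarrow> u = v"
proof (induction u arbitrary: v rule: psi.induct)
  case 1
  then show ?case by (cases v rule: psi.cases) auto
next
  case (2 w)
  then show ?case by (cases v rule: psi.cases) auto
next
  case (3 w)
  then show ?case by (cases v rule: psi.cases) auto
qed

text \<open>Every block of \<open>phi\<close> begins with its only \<open>La\<close>, so a cut in
  front of an \<open>La\<close> is a cut between blocks. This is what allows occurrences of factors
  to be pulled back along \<open>phi\<close>.\<close>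

lemma phi_eq_appendD:
  assumes "phi w = u @ v" "v = [] \<or> hd v = La"
  shows "\<exists>w1 w2. w = w1 @ w2 \<and> phi w1 = u \<and> phi w2 = v"
  using assms
proof (induction w arbitrary: u rule: phi.induct)
  case 1
  then show ?case by auto
next
  case (2 w)
  show ?case
  proof (cases u)
    case Nil
    then have "La # w = [] @ (La # w) \<and> phi [] = u \<and> phi (La # w) = v" using 2 by simp
    then show ?thesis by blast
  next
    case (Cons c u')
    then have c: "c = La" "Lb # phi w = u' @ v" using 2 by auto
    then obtain u'' where u': "u' = Lb # u''" using 2(3) by (cases u') auto
    then have "phi w = u'' @ v" using c by simp
    from 2(1)[OF this 2(3)] obtain w1 w2 where "w = w1 @ w2" "phi w1 = u''" "phi w2 = v" by blast
    then have "La # w = (La # w1) @ w2 \<and> phi (La # w1) = u \<and> phi w2 = v"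
      using Cons c u' by simp
    then show ?thesis by blast
  qed
next
  case (3 w)
  show ?case
  proof (cases u)
    case Nil
    then have "Lb # w = [] @ (Lb # w) \<and> phi [] = u \<and> phi (Lb # w) = v" using 3 by simp
    then show ?thesis by blast
  next
    case (Cons c u')
    then have c: "c = La" "phi w = u' @ v" using 3 by auto
    from 3(1)[OF c(2) 3(3)] obtain w1 w2 where "w = w1 @ w2" "phi w1 = u'" "phi w2 = v" by blast
    then have "Lb # w = (Lb # w1) @ w2 \<and> phi (Lb # w1) = u \<and> phi w2 = v"
      using Cons c by simp
    then show ?thesis by blast
  qed
qed

lemma phi_eq_append3D:
  assumes "phi w = u @ phi p @ v" "v = [] \<or> hd v = La"
  shows "\<exists>w1 w3. w = w1 @ p @ w3 \<and> phi w1 = u \<and> phi w3 = v"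
proof -
  have "phi p @ v = [] \<or> hd (phi p @ v) = La"
    using assms(2) phi_hd[of p] by (cases "phi p") auto
  from phi_eq_appendD[OF assms(1) this] obtain w1 w2
    where w: "w = w1 @ w2" "phi w1 = u" "phi w2 = phi p @ v" by blast
  from phi_eq_appendD[OF w(3) assms(2)] obtain p' w3
    where "w2 = p' @ w3" "phi p' = phi p" "phi w3 = v" by blast
  then show ?thesis using w phi_inj by blast
qed

text \<open>
  Indices are shifted by 3: the word \<open>cen m\<close> is \<open>F\<^sub>m\<^sub>+\<^sub>3\<close> without its last two letters \<open>lx m\<close> and \<open>lx (Suc m)\<close>.
\<close>

fun cen :: "nat \<Rightarrow> letter list" where
  "cen 0 = []"
| "cen (Suc m) = phi (cen m) @ [La]"

definition lx :: "nat \<Rightarrow> letter" where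
  "lx m = (if even m then La else Lb)"

lemma lx_Suc_neq [simp]: "lx (Suc m) \<noteq> lx m" "lx m \<noteq> lx (Suc m)"
  by (auto simp: lx_def)

lemma lx_Suc_Suc [simp]: "lx (Suc (Suc m)) = lx m"
  by (auto simp: lx_def)

lemma fib_word_Suc: "n \<ge> 1 \<Longrightarrow> fib_word (Suc n) = phi (fib_word n)"
proof (induction n rule: fib_word.induct)
  case (4 n)
  have "fib_word (Suc (Suc (Suc (Suc n)))) = phi (fib_word (Suc (Suc n))) @ phi (fib_word (Suc n))"
    using 4 by (subst fib_word.simps(4)) simp
  then show ?case by (simp add: phi_append del: fib_word.simps) (simp add: phi_append)
qed auto

lemma fib_word_cen: "fib_word (m + 3) = cen m @ [lx m, lx (Suc m)]"
proof (induction m)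
  case 0
  then show ?case by (simp add: lx_def numeral_3_eq_3)
next
  case (Suc m)
  have "fib_word (Suc m + 3) = phi (fib_word (m + 3))" using fib_word_Suc[of "m+3"] by simp
  then show ?case using Suc by (simp add: phi_append lx_def)
qed

lemma cen_Suc_Suc: "cen (Suc (Suc m)) = cen (Suc m) @ [lx (Suc m), lx m] @ cen m"
proof -
  have "fib_word (Suc (Suc m) + 3) = fib_word (Suc m + 3) @ fib_word (m + 3)"
    by (simp add: eval_nat_numeral)
  then show ?thesis unfolding fib_word_cen by (simp del: cen.simps)
qed

text \<open>
  The Christoffel words \<open>chw m\<close> are the rotations of \<open>F\<^sub>m\<^sub>+\<^sub>3\<close> that move the last letter to the
  front. They are what remains once \<open>Lb La\<close> has been replaced instead of \<open>La Lb\<close>.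
\<close>

definition chw :: "nat \<Rightarrow> letter list" where
  "chw m = lx (Suc m) # cen m @ [lx m]"

definition fibw :: "nat \<Rightarrow> letter list \<Rightarrow> bool" where
  "fibw m w \<longleftrightarrow> w = cen m @ [lx m, lx (Suc m)] \<or> w = chw m"

lemma chw_phi: "even m \<Longrightarrow> chw (Suc m) = phi (chw m)"
  by (simp add: chw_def lx_def phi_append)

lemma chw_psi:
  assumes "odd m"
  shows "chw (Suc m) = psi (chw m)"
  using assms phi_psi[of "cen m"] by (simp add: chw_def lx_def psi_append)

text \<open>Here Christoffel words enter: a Fibonacci word that ends in \<open>La\<close> is also an
  image under \<open>psi\<close>, but of a Christoffel word.\<close>

lemma cen_psi:
  assumes "even m"
  shows "cen (Suc m) @ [lx (Suc m), lx m] = psi (chw m)"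
  using assms arg_cong[OF phi_psi[of "cen m"], of "\<lambda>u. u @ [Lb, La]"]
  by (simp add: chw_def lx_def psi_append)

lemma fibw_phi:
  assumes "fibw (Suc m) w" "hd w = La"
  shows "\<exists>w'. fibw m w' \<and> w = phi w'"
proof -
  consider "w = cen (Suc m) @ [lx (Suc m), lx m]" | "w = chw (Suc m)" "even m"
    using assms by (auto simp: fibw_def chw_def lx_def split: if_splits)
  then show ?thesis
  proof cases
    case 1
    then have "w = phi (cen m @ [lx m, lx (Suc m)])" by (simp add: phi_append lx_def)
    then show ?thesis by (auto simp: fibw_def)
  next
    case 2
    then show ?thesis using chw_phi by (auto simp: fibw_def)
  qed
qed

lemma fibw_psi:
  assumes "fibw (Suc m) w" "last w = La"
  shows "\<exists>w'. fibw m w' \<and> w = psi w'"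
proof -
  consider "w = cen (Suc m) @ [lx (Suc m), lx m]" "even m" | "w = chw (Suc m)" "odd m"
    using assms by (auto simp: fibw_def chw_def lx_def split: if_splits)
  then show ?thesis
    using chw_psi cen_psi by (cases) (auto simp: fibw_def)
qed

text \<open>The form \<open>cen n @ [lx n]\<close> is common to both kinds of words: it is the
  Fibonacci word without its last letter and the Christoffel word without its first.\<close>

lemma cen_lx_prefix:
  assumes "m \<le> n"
  shows "\<exists>z. cen n @ [lx n] = cen m @ [lx m] @ z"
  using assms
proof (induction rule: dec_induct)
  case (step n)
  have "\<exists>z. cen (Suc n) @ [lx (Suc n)] = cen n @ [lx n] @ z"
  proof (cases n)
    case 0
    then show ?thesis by (simp add: lx_def)
  next
    case (Suc n')
    then show ?thesis by (simp add: cen_Suc_Suc del: cen.simps)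
  qed
  then show ?case using step.IH by (metis append.assoc)
qed auto

lemma length_cen_Suc_Suc:
  "length (cen (Suc (Suc m))) = length (cen (Suc m)) + length (cen m) + 2"
  by (simp add: cen_Suc_Suc del: cen.simps)

lemma length_cen_less: "length (cen m) < length (cen (Suc m))"
  by (cases m) (simp, simp add: length_cen_Suc_Suc del: cen.simps)

section \<open>Factors without an earlier occurrence\<close>

text \<open>These factors define the windows. An occurrence is pulled back along \<open>phi\<close>
  to an occurrence of the factor of the previous index; the two parities differ in how the outer
  letters of the factor fit into blocks.\<close>

lemma lx_cen_lx_not_sublist:
  "\<not> sublist (lx m # cen m @ [lx m]) (cen (Suc m) @ [lx (Suc m)])"
proof (induction m)
  case 0
  then show ?case by (auto simp: lx_def sublist_Cons_right)
next
  case (Suc m)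
  show ?case
  proof (cases "even m")
    case True
    show ?thesis
    proof
      assume "sublist (lx (Suc m) # cen (Suc m) @ [lx (Suc m)])
                (cen (Suc (Suc m)) @ [lx (Suc (Suc m))])"
      then obtain u v where uv: "phi (cen (Suc m)) @ [La, La] = u @ (Lb # phi (cen m) @ [La, Lb]) @ v"
        using True by (auto simp: sublist_def lx_def)
      \<comment> \<open>The trailing \<open>La La\<close> is read as the image of two artificial
        letters \<open>Lb Lb\<close>. The occurrence pulled back ends in \<open>La\<close>, so it
        cannot reach them, and they are removed again below.\<close>
      have "phi (cen (Suc m) @ [Lb, Lb]) = (u @ [Lb]) @ (phi (cen m) @ [La, Lb] @ v)"
        using uv by (simp add: phi_append)
      moreover have "hd (phi (cen m) @ [La, Lb] @ v) = La"
        using phi_hd[of "cen m"] by (cases "phi (cen m)") auto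
      ultimately obtain w1 w2 where w: "cen (Suc m) @ [Lb, Lb] = w1 @ w2" "phi w1 = u @ [Lb]"
          "phi w2 = phi (cen m) @ [La, Lb] @ v"
        using phi_eq_appendD by meson
      have "\<exists>w1'. w1 = w1' @ [La]"
        using w(2) by (cases w1 rule: rev_exhaust) (auto simp: phi_append, metis letter.exhaust
            append_is_Nil_conv butlast_snoc last.simps last_snoc letter.distinct(1) list.discI phi.simps(1,3) )
      then obtain w1' where w1': "w1 = w1' @ [La]" by blast
      have "phi w2 = [] @ phi (cen m) @ [La, Lb] @ v" using w(3) by simp
      then obtain w3 where w3: "w2 = cen m @ w3" "phi w3 = [La, Lb] @ v"
        using phi_eq_append3D[of w2 "[]" "cen m" "[La, Lb] @ v"]
        by (auto, metis append_self_conv2 phi.simps(1) phi_inj)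
      obtain w4 where w4: "w3 = La # w4"
        using w3(2) by (cases w3 rule: phi.cases) (auto simp: phi_not_Lb)
      have eq: "cen (Suc m) @ [Lb, Lb] = w1' @ (La # cen m @ [La]) @ w4"
        using w(1) w1' w3(1) w4 by simp
      have "suffix [Lb, Lb] w4"
      proof (cases w4 rule: rev_exhaust)
        case (snoc w5 c)
        then show ?thesis using eq by (cases w5 rule: rev_exhaust) (auto simp: suffix_def)
      qed (use eq in auto)
      then obtain w5 where "w4 = w5 @ [Lb, Lb]" by (auto simp: suffix_def)
      then have "cen (Suc m) = w1' @ (La # cen m @ [La]) @ w5" using eq by simp
      then have "sublist (La # cen m @ [La]) (cen (Suc m) @ [lx (Suc m)])"
        by (metis append.assoc sublist_appendI)
      then show False using Suc True by (simp add: lx_def)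
    qed
  next
    case False
    show ?thesis
    proof
      assume "sublist (lx (Suc m) # cen (Suc m) @ [lx (Suc m)])
                (cen (Suc (Suc m)) @ [lx (Suc (Suc m))])"
      then obtain u v where uv: "phi (cen (Suc m)) @ [La, Lb] = u @ (La # phi (cen m) @ [La, La]) @ v"
        using False by (auto simp: sublist_def lx_def)
      \<comment> \<open>Here the factor consists of whole blocks except for its last
        \<open>La\<close>, which only opens the next block.\<close>
      then have "phi (cen (Suc m) @ [La]) = u @ phi (Lb # cen m @ [Lb]) @ (La # v)"
        by (simp add: phi_append)
      then obtain w1 w3 where "cen (Suc m) @ [La] = w1 @ (Lb # cen m @ [Lb]) @ w3"
        using phi_eq_append3D[of "cen (Suc m) @ [La]" u "Lb # cen m @ [Lb]" "La # v"] by auto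
      then have "sublist (Lb # cen m @ [Lb]) (cen (Suc m) @ [La])"
        by (metis sublist_appendI)
      then show False using Suc False by (simp add: lx_def)
    qed
  qed
qed

text \<open>Pulling back along \<open>phi\<close> leaves a nonempty rest on both sides, so an inner
  occurrence stays an inner one. For \<open>m = 0\<close> the factor is empty and the claim
  fails.\<close>

lemma cen_not_sublist: "m \<ge> 1 \<Longrightarrow> \<not> sublist (cen m) (tl (butlast (cen (Suc m))))"
proof (induction m rule: dec_induct)
  case base
  then show ?case by (simp add: sublist_Cons_right)
next
  case (step m)
  show ?case
  proof
    assume "sublist (cen (Suc m)) (tl (butlast (cen (Suc (Suc m)))))"
    then have "sublist (phi (cen m) @ [La]) (tl (phi (cen (Suc m))))"
      by (metis butlast_snoc cen.simps(2))
    then obtain u v where uv: "tl (phi (cen (Suc m))) = u @ (phi (cen m) @ [La]) @ v"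
      by (auto simp: sublist_def)
    then obtain c where "phi (cen (Suc m)) = (c # u) @ phi (cen m) @ (La # v)"
      by (cases "phi (cen (Suc m))") auto
    then obtain w1 w3 where w: "cen (Suc m) = w1 @ cen m @ w3" "phi w1 = c # u" "phi w3 = La # v"
      using phi_eq_append3D[of "cen (Suc m)" "c # u" "cen m" "La # v"] by auto
    obtain d w1' where "w1 = d # w1'" using w(2) by (cases w1) auto
    moreover obtain w3' e where "w3 = w3' @ [e]" using w(3) by (cases w3 rule: rev_exhaust) auto
    ultimately have "tl (butlast (cen (Suc m))) = w1' @ cen m @ w3'" using w(1)
      by (simp add: butlast_append del: cen.simps(2))
    then show False using step by simp
  qed
qed

section \<open>Occurrences of non-terminals in a derivation\<close>

type_synonym rules = "nat \<Rightarrow> (nat \<times> nat) option"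

text \<open>
  Every label without a rule counts as a terminal. In this way, a bigram that has been replaced
  becomes a letter when its rule is removed, without any renumbering.
\<close>

fun expand :: "rules \<Rightarrow> nat \<Rightarrow> nat list" where
  "expand R i = (case R i of None \<Rightarrow> [i]
     | Some (j, k) \<Rightarrow> if j < i \<and> k < i then expand R j @ expand R k else [i])"

declare expand.simps [simp del]

abbreviation len :: "rules \<Rightarrow> nat \<Rightarrow> nat" where
  "len R i \<equiv> length (expand R i)"

text \<open>A node of the derivation tree is represented by its label and the position at which its
  expansion starts. In an acyclic system this identifies the node, so no paths in the tree are
  needed.\<close>

inductive occ :: "rules \<Rightarrow> nat \<Rightarrow> nat \<Rightarrow> nat \<Rightarrow> bool" for R where
  occ_self: "occ R r r 0"
| occ_left: "R r = Some (j, k) \<Longrightarrow> occ R j i s \<Longrightarrow> occ R r i s"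
| occ_right: "R r = Some (j, k) \<Longrightarrow> occ R k i s \<Longrightarrow> occ R r i (len R j + s)"

definition binaries :: "rules \<Rightarrow> nat \<Rightarrow> nat set" where
  "binaries R r = {i. (\<exists>s. occ R r i s) \<and> R i \<noteq> None}"

definition first :: "rules \<Rightarrow> nat \<Rightarrow> nat \<Rightarrow> nat" where
  "first R r i = (LEAST s. occ R r i s)"

definition mid :: "rules \<Rightarrow> nat \<Rightarrow> nat \<Rightarrow> nat" where
  "mid R r i = first R r i + len R (fst (the (R i)))"

abbreviation mids :: "rules \<Rightarrow> nat \<Rightarrow> nat set" where
  "mids R r \<equiv> mid R r ` binaries R r"

locale acyclic_rules =
  fixes R :: rules
  assumes acyclic: "R i = Some (j, k) \<Longrightarrow> j < i \<and> k < i"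
begin

lemmas occ_leftI = occ.occ_left[of R] and occ_rightI = occ.occ_right[of R]

lemma expand_None: "R i = None \<Longrightarrow> expand R i = [i]"
  by (simp add: expand.simps)

lemma expand_Some: "R i = Some (j, k) \<Longrightarrow> expand R i = expand R j @ expand R k"
  using acyclic by (simp add: expand.simps)

lemma rules_induct [case_names None Some]:
  assumes "\<And>i. R i = None \<Longrightarrow> P i"
    and "\<And>i j k. R i = Some (j, k) \<Longrightarrow> P j \<Longrightarrow> P k \<Longrightarrow> P i"
  shows "P i"
proof (induction i rule: less_induct)
  case (less i)
  show ?case
  proof (cases "R i")
    case (Some p)
    then show ?thesis using assms(2)[of i "fst p" "snd p"] acyclic[of i "fst p" "snd p"] less by simp
  qed (use assms in auto)
qed

lemma len_pos: "len R i > 0"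
  by (induction i rule: rules_induct) (simp_all add: expand_None expand_Some)

lemma expand_nonempty [simp]: "expand R i \<noteq> []"
  using len_pos[of i] by auto

lemma len_Some: "R i = Some (j, k) \<Longrightarrow> len R i = len R j + len R k"
  by (simp add: expand_Some)

lemma len_eq_1: "len R i = 1 \<Longrightarrow> R i = None"
proof (cases "R i")
  case (Some p)
  assume "len R i = 1"
  then show ?thesis using expand_Some[of i "fst p" "snd p"] Some len_pos[of "fst p"] len_pos[of "snd p"]
    by simp
qed

lemma expand_leaves: "x \<in> set (expand R i) \<Longrightarrow> R x = None"
  by (induction i rule: rules_induct) (auto simp: expand_None expand_Some)

lemma occ_None: "R r = None \<Longrightarrow> occ R r i s \<longleftrightarrow> i = r \<and> s = 0"
  by (auto elim: occ.cases intro: occ.intros)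

lemma occ_Some: "R r = Some (j, k) \<Longrightarrow> occ R r i s \<longleftrightarrow>
    i = r \<and> s = 0 \<or> occ R j i s \<or> (\<exists>s'. occ R k i s' \<and> s = len R j + s')"
  by (subst occ.simps) auto

lemma occ_le: "occ R r i s \<Longrightarrow> i \<le> r"
  by (induction rule: occ.induct) (use acyclic in force)+

lemma occ_cycle:
  assumes "occ R i i s"
  shows "s = 0"
  using assms
proof cases
  case (occ_left j k)
  then show ?thesis using acyclic[of i j k] occ_le[of j i s] by simp
next
  case (occ_right j k s')
  then show ?thesis using acyclic[of i j k] occ_le[of k i s'] by simp
qed simp

lemma occ_trans: "occ R r q s \<Longrightarrow> occ R q i d \<Longrightarrow> occ R r i (s + d)"
  by (induction rule: occ.induct) (auto intro: occ.intros simp: add.assoc)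

lemma occ_expand: "occ R r i s \<Longrightarrow> \<exists>u v. expand R r = u @ expand R i @ v \<and> length u = s"
proof (induction rule: occ.induct)
  case (occ_self r)
  then show ?case by auto
next
  case (occ_left r j k i s)
  then obtain u v where uv: "expand R j = u @ expand R i @ v" "length u = s" by blast
  then have "expand R r = u @ expand R i @ (v @ expand R k)"
    using occ_left by (simp add: expand_Some)
  then show ?case using uv by blast
next
  case (occ_right r j k i s)
  then obtain u v where uv: "expand R k = u @ expand R i @ v" "length u = s" by blast
  then have "expand R r = (expand R j @ u) @ expand R i @ v"
    using occ_right by (simp add: expand_Some)
  then show ?case using uv by (metis length_append)
qed

lemma occ_len: "occ R r i s \<Longrightarrow> s + len R i \<le> len R r"
  using occ_expand by fastforce

lemma occ_nth: "occ R r i s \<Longrightarrow> p < len R i \<Longrightarrow> expand R r ! (s + p) = expand R i ! p"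
  by (drule occ_expand) (auto simp: nth_append)

lemma occ_laminar:
  assumes "occ R r i s" "occ R r i' s'"
  shows "s + len R i \<le> s' \<or> s' + len R i' \<le> s \<or>
    s \<le> s' \<and> occ R i i' (s' - s) \<or> s' \<le> s \<and> occ R i' i (s - s')"
  using assms
proof (induction r arbitrary: s s' rule: rules_induct)
  case (None r)
  then show ?case by (auto simp: occ_None)
next
  case (Some r j k)
  from Some(4)[unfolded occ_Some[OF Some(1)]] show ?case
  proof (elim disjE exE conjE, goal_cases)
    case 1
    then show ?case using Some(5) by auto
  next
    case 2
    note l1 = this
    from Some(5)[unfolded occ_Some[OF Some(1)]] show ?case
    proof (elim disjE exE conjE, goal_cases)
      case 1
      then show ?case using Some(4) by auto
    next
      case 2
      then show ?case using Some(2) l1 by blast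
    next
      case (3 s2)
      then show ?case using occ_len[OF l1] by auto
    qed
  next
    case (3 s1)
    note l1 = this
    from Some(5)[unfolded occ_Some[OF Some(1)]] show ?case
    proof (elim disjE exE conjE, goal_cases)
      case 1
      then show ?case using Some(4) by auto
    next
      case 2
      then show ?case using occ_len[OF 2] l1 by auto
    next
      case (3 s2)
      then show ?case using Some(3)[OF l1(1) 3(1)] l1 by auto
    qed
  qed
qed

lemma occ_same_disjoint:
  assumes "occ R r i s" "occ R r i s'" "s < s'"
  shows "s + len R i \<le> s'"
  using occ_laminar[OF assms(1,2)] assms(3) len_pos[of i] by (auto dest: occ_cycle)

lemma occ_child_cases:
  assumes "occ R r i s" "i \<noteq> r"
  obtains q j k sq where "occ R r q sq" "R q = Some (j, k)"
    "i = j \<and> s = sq \<or> i = k \<and> s = sq + len R j"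
proof -
  have "\<exists>q j k sq. occ R r q sq \<and> R q = Some (j, k) \<and>
    (i = j \<and> s = sq \<or> i = k \<and> s = sq + len R j)"
    using assms
  proof (induction rule: occ.induct)
    case (occ_left r j k i s)
    show ?case
    proof (cases "i = j")
      case True
      then show ?thesis using occ_left occ_cycle occ.occ_self by blast
    next
      case False
      then show ?thesis using occ_left occ.occ_left by meson
    qed
  next
    case (occ_right r j k i s)
    show ?case
    proof (cases "i = k")
      case True
      then show ?thesis using occ_right occ_cycle occ.occ_self by fastforce
    next
      case False
      with occ_right obtain q j' k' sq where "occ R k q sq" "R q = Some (j', k')"
        "i = j' \<and> s = sq \<or> i = k' \<and> s = sq + len R j'" by blast
      then show ?thesis using occ_rightI[OF occ_right(1)]
        by (metis add.assoc)
    qed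
  qed simp
  then show ?thesis using that by blast
qed

text \<open>Walk up from the node as long as it is reached through left children. The first step up
  from a right child leads to the ancestor \<open>q\<close>, which splits exactly where the node
  starts.\<close>

lemma occ_start_cases:
  assumes "occ R r i s"
  shows "s = 0 \<or> (\<exists>q j k sq. occ R r q sq \<and> R q = Some (j, k) \<and> s = sq + len R j \<and>
      occ R q i (len R j))"
  using assms
proof (induction rule: occ.induct)
  case (occ_left r j k i s)
  then show ?case using occ_leftI[OF occ_left(1)] by metis
next
  case (occ_right r j k i s)
  show ?case
  proof (cases "s = 0")
    case True
    then have "occ R r i (len R j)" using occ_rightI[OF occ_right(1,2)] by simp
    then show ?thesis using occ_right True occ.occ_self by fastforce
  next
    case False
    with occ_right(3) obtain q j' k' sq where "occ R k q sq" "R q = Some (j', k')"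
      "s = sq + len R j'" "occ R q i (len R j')" by auto
    then show ?thesis using occ_rightI[OF occ_right(1)] by (metis add.assoc)
  qed
qed simp

lemma occ_end_cases:
  assumes "occ R r i s"
  shows "s + len R i = len R r \<or> (\<exists>q j k sq. occ R r q sq \<and> R q = Some (j, k) \<and>
      s + len R i = sq + len R j \<and> sq \<le> s \<and> occ R q i (s - sq))"
  using assms
proof (induction rule: occ.induct)
  case (occ_left r j k i s)
  show ?case
  proof (cases "s + len R i = len R j")
    case True
    then show ?thesis using occ_left occ.occ_self[of R r] occ_leftI[OF occ_left(1,2)] by force
  next
    case False
    then show ?thesis using occ_left occ.occ_left by meson
  qed
next
  case (occ_right r j k i s)
  show ?case
  proof (cases "s + len R i = len R k")
    case True
    then show ?thesis using occ_right by (simp add: expand_Some)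
  next
    case False
    with occ_right(3) obtain q j' k' sq where q: "occ R k q sq" "R q = Some (j', k')"
      "s + len R i = sq + len R j'" "sq \<le> s" "occ R q i (s - sq)" by auto
    have "occ R r q (len R j + sq)" using occ_rightI[OF occ_right(1) q(1)] .
    moreover have "len R j + s + len R i = len R j + sq + len R j'" using q by simp
    moreover have "len R j + s - (len R j + sq) = s - sq" by simp
    ultimately show ?thesis using q by (metis add_le_cancel_left)
  qed
qed simp

text \<open>The lowest node covering the positions from \<open>a\<close> to \<open>b\<close> must
  split strictly between them, since otherwise one of its children would cover them as well.\<close>

lemma occ_window:
  assumes "a + 2 \<le> b" "b \<le> len R r"
  shows "\<exists>i s j k. occ R r i s \<and> R i = Some (j, k) \<and> s \<le> a \<and> b \<le> s + len R i \<and>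
    a < s + len R j \<and> s + len R j < b"
  using assms
proof (induction r arbitrary: a b rule: rules_induct)
  case (None r)
  then show ?case by (simp add: expand_None)
next
  case (Some r j k)
  consider "b \<le> len R j" | "len R j \<le> a" | "a < len R j" "len R j < b" by linarith
  then show ?case
  proof cases
    case 1
    then show ?thesis using Some(2)[OF Some(4)] occ_leftI[OF Some(1)] by meson
  next
    case 2
    have "a - len R j + 2 \<le> b - len R j" "b - len R j \<le> len R k"
      using Some(4,5) 2 by (auto simp: expand_Some[OF Some(1)])
    from Some(3)[OF this] obtain i s j' k' where i: "occ R k i s" "R i = Some (j', k')"
      "s \<le> a - len R j" "b - len R j \<le> s + len R i" "a - len R j < s + len R j'"
      "s + len R j' < b - len R j" by blast
    have "occ R r i (len R j + s)" using occ_rightI[OF Some(1) i(1)] .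
    moreover have "len R j + s \<le> a" "b \<le> len R j + s + len R i" "a < len R j + s + len R j'"
      "len R j + s + len R j' < b" using i 2 Some(4) by auto
    ultimately show ?thesis using i(2) by blast
  next
    case 3
    have "occ R r r 0" by (rule occ_self)
    then show ?thesis using 3 Some by fastforce
  qed
qed

lemma first_occ: "occ R r i s \<Longrightarrow> occ R r i (first R r i) \<and> first R r i \<le> s"
  unfolding first_def by (metis LeastI Least_le)

lemma occ_leaf: "p < len R r \<Longrightarrow> occ R r (expand R r ! p) p"
proof (induction r arbitrary: p rule: rules_induct)
  case (None r)
  then show ?case using occ_self by (simp add: expand_None)
next
  case (Some r j k)
  show ?case
  proof (cases "p < len R j")
    case True
    then show ?thesis using Some occ_leftI[OF Some(1)] by (simp add: expand_Some nth_append)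
  next
    case False
    then have "occ R k (expand R k ! (p - len R j)) (p - len R j)"
      using Some by (auto simp: expand_Some)
    then show ?thesis using occ_rightI[OF Some(1)] False by (force simp: expand_Some[OF Some(1)] nth_append)
  qed
qed

lemma mid_Some: "R i = Some (j, k) \<Longrightarrow> mid R r i = first R r i + len R j"
  by (simp add: mid_def)

lemma mid_mem: "occ R r i s \<Longrightarrow> R i = Some (j, k) \<Longrightarrow> first R r i + len R j \<in> mids R r"
  using mid_Some[of i j k r] by (force simp: binaries_def)

text \<open>
  Ancestors of a leftmost occurrence are leftmost occurrences themselves. Hence the ends of a
  leftmost occurrence are split points of other leftmost occurrences.
\<close>

lemma first_start:
  assumes "occ R r i s"
  shows "first R r i = 0 \<or> first R r i \<in> mids R r"
proof -
  have f: "occ R r i (first R r i)" using first_occ[OF assms] by simp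
  have "first R r i \<in> mids R r" if q: "occ R r q sq" "R q = Some (j, k)"
    "first R r i = sq + len R j" "occ R q i (len R j)" for q j k sq
  proof -
    have "occ R r i (first R r q + len R j)"
      using occ_trans first_occ[OF q(1)] q(4) by blast
    then have "first R r i \<le> first R r q + len R j" using first_occ by blast
    then have "first R r i = first R r q + len R j" using first_occ[OF q(1)] q(3) by simp
    then show ?thesis using mid_mem q by metis
  qed
  then show ?thesis using occ_start_cases[OF f] by blast
qed

lemma first_end:
  assumes "occ R r i s"
  shows "first R r i + len R i = len R r \<or> first R r i + len R i \<in> mids R r"
proof -
  have f: "occ R r i (first R r i)" using first_occ[OF assms] by simp
  have "first R r i + len R i \<in> mids R r" if q: "occ R r q sq" "R q = Some (j, k)"
    "first R r i + len R i = sq + len R j" "sq \<le> first R r i" "occ R q i (first R r i - sq)" for q j k sq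
  proof -
    have "occ R r i (first R r q + (first R r i - sq))"
      using occ_trans first_occ[OF q(1)] q(5) by blast
    then have "first R r i \<le> first R r q + (first R r i - sq)" using first_occ by blast
    moreover have "first R r q \<le> sq" using first_occ[OF q(1)] by simp
    ultimately have "first R r q = sq" using q(4) by linarith
    then show ?thesis using mid_mem[OF q(1,2)] q(3) by metis
  qed
  then show ?thesis using occ_end_cases[OF f] by blast
qed

lemma expand_take_drop:
  assumes "occ R r i s"
  shows "take (len R i) (drop s (expand R r)) = expand R i"
  using occ_expand[OF assms] by auto

text \<open>The lowest node covering \<open>v\<close> is a leftmost occurrence: occurrences of the
  same label are disjoint, so an earlier one would lie inside \<open>u\<close> and carry a copy of
  \<open>v\<close> with it. For the same reason an earlier occurrence of \<open>v\<close> that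
  overlaps this one does no harm; only copies within \<open>u\<close> have to be excluded.\<close>

lemma window_split:
  assumes w: "expand R r = u @ v @ z" and v: "length v \<ge> 2"
    and nosub: "\<not> sublist v u"
  shows "\<exists>m \<in> mids R r. length u < m \<and> m < length u + length v"
proof -
  have "length u + length v \<le> len R r" using w by simp
  with v obtain i s j k where i: "occ R r i s" "R i = Some (j, k)" "s \<le> length u"
    "length u + length v \<le> s + len R i" "length u < s + len R j" "s + len R j < length u + length v"
    using occ_window[of "length u" "length u + length v" r] by auto
  have "first R r i = s"
  proof (rule ccontr)
    assume ne: "first R r i \<noteq> s"
    let ?f = "first R r i"
    from ne have "?f < s" "occ R r i ?f" using first_occ[OF i(1)] by auto
    then have d: "?f + len R i \<le> s" using occ_same_disjoint i(1) by blast
    have v': "v = take (length v) (drop (length u - s) (expand R i))"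
    proof -
      have "take (length v) (drop (length u - s) (take (len R i) (drop s (expand R r)))) = v"
        using w i(3,4) by (simp add: drop_take min_def)
      then show ?thesis using expand_take_drop[OF i(1)] by simp
    qed
    have "sublist v (expand R i)" by (metis v' sublist_drop sublist_order.order.trans sublist_take)
    moreover have "sublist (expand R i) u"
    proof -
      have "?f + len R i \<le> length u" using d i(3) by simp
      then have "take (len R i) (drop ?f (expand R r)) = take (len R i) (drop ?f u)"
        using w by simp
      then have "expand R i = take (len R i) (drop ?f u)"
        using expand_take_drop[of r i ?f] first_occ[OF i(1)] by simp
      then show ?thesis by (metis sublist_drop sublist_order.order.trans sublist_take)
    qed
    ultimately show False using nosub by (meson sublist_order.order.trans)
  qed
  then show ?thesis using mid_mem[OF i(1,2)] i by blast
qed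

lemma finite_binaries [simp]: "finite (binaries R r)"
  by (rule finite_subset[of _ "{..r}"]) (auto simp: binaries_def dest: occ_le)

end

section \<open>Small rule systems for Fibonacci and Christoffel words\<close>

text \<open>
  The number of the window containing a position; window \<open>Suc i\<close> begins at \<open>length (cen i) + 2\<close>.
\<close>

definition rank :: "nat \<Rightarrow> nat" where
  "rank x = (LEAST i. x < length (cen i) + 2)"

lemma length_cen_mono: "i \<le> j \<Longrightarrow> length (cen i) \<le> length (cen j)"
  by (rule lift_Suc_mono_le[of "\<lambda>i. length (cen i)"]) (use length_cen_less less_imp_le in auto)

lemma length_cen_ge: "i \<le> length (cen i)"
  by (induction i) (use length_cen_less in \<open>auto intro: le_less_trans simp: Suc_le_eq simp del: cen.simps(2)\<close>)

lemma rank_0: "x < 2 \<Longrightarrow> rank x = 0"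
  by (simp add: rank_def Least_eq_0)

lemma rank_Suc:
  assumes "length (cen i) + 2 \<le> x" "x < length (cen (Suc i)) + 2"
  shows "rank x = Suc i"
  unfolding rank_def
proof (rule Least_equality)
  fix j assume "x < length (cen j) + 2"
  then show "Suc i \<le> j" using assms(1) length_cen_mono[of j i] by (meson leD leI le_trans add_le_mono1 not_less_eq_eq)
qed (use assms in auto)

lemma rank_cases:
  obtains "x < 2" | i where "length (cen i) + 2 \<le> x" "x < length (cen (Suc i)) + 2"
proof (cases "rank x")
  case 0
  have "x < length (cen (rank x)) + 2" unfolding rank_def
    using LeastI[of "\<lambda>i. x < length (cen i) + 2" x] length_cen_ge[of x] by simp
  then show ?thesis using 0 that by simp
next
  case (Suc i)
  have "x < length (cen (rank x)) + 2" unfolding rank_def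
    using LeastI[of "\<lambda>i. x < length (cen i) + 2" x] length_cen_ge[of x] by simp
  moreover have "\<not> x < length (cen i) + 2"
    using Suc not_less_Least[of i "\<lambda>i. x < length (cen i) + 2"] by (simp add: rank_def)
  ultimately show ?thesis using Suc that(2)[of i] by (simp del: cen.simps)
qed

lemma sublist_Cons_tl:
  assumes "sublist (x # v) (c # u)"
  shows "sublist v u"
proof -
  obtain ps ss where e: "c # u = ps @ (x # v) @ ss" using assms by (auto simp: sublist_def)
  show ?thesis
  proof (cases ps)
    case Nil
    then have "u = [] @ v @ ss" using e by simp
    then show ?thesis by (metis sublist_appendI)
  next
    case (Cons p ps')
    then have "u = (ps' @ [x]) @ v @ ss" using e by simp
    then show ?thesis by (metis sublist_appendI)
  qed
qed

section \<open>Windows that contain a split point\<close>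

context acyclic_rules
begin

lemma window_split_map:
  assumes "map \<tau> (expand R r) = u @ v @ z" "\<not> sublist v u" "length v \<ge> 2"
    and "lo = Suc (length u)" "Suc hi = length u + length v"
  shows "\<exists>m \<in> mids R r. lo \<le> m \<and> m \<le> hi"
proof -
  obtain u' v' z' where e: "expand R r = u' @ v' @ z'" "u = map \<tau> u'" "v = map \<tau> v'"
    using assms(1) by (smt (verit) append_eq_map_conv)
  have "\<not> sublist v' u'"
    using assms(2) e by (metis map_append sublist_def)
  with window_split[OF e(1)] assms(3) e obtain m where "m \<in> mids R r" "length u < m"
    "m < length u + length v" by auto
  then show ?thesis using assms(4,5) by (intro bexI[of _ m]) auto
qed

text \<open>By the recursion of \<open>cen\<close>, the prefix
  \<open>cen (Suc q) @ [lx (Suc q)]\<close> is followed by a factor that does not occur in it. The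
  range omits the last position of the window with number \<open>Suc (Suc q)\<close>;
  \<open>fib_isolated\<close> relies on that gap.\<close>

lemma fib_window:
  assumes w: "map \<tau> (expand R r) = cen N @ [lx N, lx (Suc N)]" and q: "Suc (Suc q) \<le> N"
  shows "\<exists>m \<in> mids R r. length (cen (Suc q)) + 2 \<le> m \<and> m \<le> length (cen (Suc (Suc q)))"
proof -
  obtain z where "cen N @ [lx N] = cen (Suc (Suc q)) @ [lx q] @ z"
    using cen_lx_prefix[OF q] by (auto simp del: cen.simps)
  then have "cen N @ [lx N, lx (Suc N)] = cen (Suc (Suc q)) @ [lx q] @ z @ [lx (Suc N)]"
    by (metis append.assoc append_Cons append_Nil)
  then have "map \<tau> (expand R r) = (cen (Suc q) @ [lx (Suc q)]) @ (lx q # cen q @ [lx q]) @ z @ [lx (Suc N)]"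
    unfolding w cen_Suc_Suc by simp
  then show ?thesis
    by (rule window_split_map[OF _ lx_cen_lx_not_sublist]) (auto simp: length_cen_Suc_Suc simp del: cen.simps)
qed

text \<open>The leading letter shifts the word by one position; the factor is extended to the left
  by \<open>lx (Suc q)\<close> to compensate. The range is then the complete window.\<close>

lemma chw_window:
  assumes w: "map \<tau> (expand R r) = c # cen N @ [lx N]" and q: "Suc (Suc q) \<le> N"
  shows "\<exists>m \<in> mids R r. length (cen (Suc q)) + 2 \<le> m \<and> m \<le> length (cen (Suc (Suc q))) + 1"
proof -
  obtain z where "cen N @ [lx N] = cen (Suc (Suc q)) @ [lx q] @ z"
    using cen_lx_prefix[OF q] by (auto simp del: cen.simps)
  then have e: "map \<tau> (expand R r) = (c # cen (Suc q)) @ (lx (Suc q) # lx q # cen q @ [lx q]) @ z"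
    unfolding w cen_Suc_Suc by simp
  have "\<not> sublist (lx (Suc q) # lx q # cen q @ [lx q]) (c # cen (Suc q))"
  proof
    assume "sublist (lx (Suc q) # lx q # cen q @ [lx q]) (c # cen (Suc q))"
    then have "sublist (lx q # cen q @ [lx q]) (cen (Suc q))" by (rule sublist_Cons_tl)
    then have "sublist (lx q # cen q @ [lx q]) (cen (Suc q) @ [lx (Suc q)])"
      by (meson sublist_append_rightI sublist_order.order.trans)
    then show False using lx_cen_lx_not_sublist by blast
  qed
  then show ?thesis
    by (rule window_split_map[OF e]) (auto simp: length_cen_Suc_Suc simp del: cen.simps)
qed

text \<open>Compared with \<open>chw_window\<close>, the letter \<open>lx (Suc q)\<close> goes back
  into the prefix, and the first position of the window drops out. This works for a leading letter
  \<open>lx (Suc q)\<close>, because the factor starts with the other letter and so cannot occur at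
  the very beginning.\<close>

lemma chw_even_window:
  assumes w: "map \<tau> (expand R r) = lx (Suc q) # cen N @ [lx N]" and q: "Suc (Suc q) \<le> N"
  shows "\<exists>m \<in> mids R r. length (cen (Suc q)) + 3 \<le> m \<and> m \<le> length (cen (Suc (Suc q))) + 1"
proof -
  obtain z where "cen N @ [lx N] = cen (Suc (Suc q)) @ [lx q] @ z"
    using cen_lx_prefix[OF q] by (auto simp del: cen.simps)
  then have e: "map \<tau> (expand R r) = (lx (Suc q) # cen (Suc q) @ [lx (Suc q)]) @ (lx q # cen q @ [lx q]) @ z"
    unfolding w cen_Suc_Suc by simp
  have "\<not> sublist (lx q # cen q @ [lx q]) (lx (Suc q) # cen (Suc q) @ [lx (Suc q)])"
    using lx_cen_lx_not_sublist[of q] by (auto simp: sublist_Cons_right simp del: cen.simps)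
  then show ?thesis
    by (rule window_split_map[OF e]) (auto simp: length_cen_Suc_Suc simp del: cen.simps)
qed

text \<open>Taking the last letter of \<open>cen (Suc q)\<close> into the factor moves the range one
  position to the left: it contains the last position of the preceding window and omits its own last
  one. A copy in the prefix would give an inner occurrence of \<open>cen q\<close> in
  \<open>cen (Suc q)\<close>.\<close>

lemma chw_odd_window:
  assumes w: "map \<tau> (expand R r) = c # cen N @ [lx N]" and q: "Suc (Suc q) \<le> N" "q \<ge> 1"
  shows "\<exists>m \<in> mids R r. length (cen (Suc q)) + 1 \<le> m \<and> m \<le> length (cen (Suc (Suc q)))"
proof -
  obtain z where "cen N @ [lx N] = cen (Suc (Suc q)) @ [lx q] @ z"
    using cen_lx_prefix[OF q(1)] by (auto simp del: cen.simps)
  moreover obtain d where d: "cen (Suc q) = butlast (cen (Suc q)) @ [d]" by auto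
  ultimately have e: "map \<tau> (expand R r) = (c # butlast (cen (Suc q))) @ (d # lx (Suc q) # lx q # cen q) @ lx q # z"
    unfolding w cen_Suc_Suc by (metis append.assoc append_Cons append_Nil)
  have "\<not> sublist (d # lx (Suc q) # lx q # cen q) (c # butlast (cen (Suc q)))"
  proof
    assume "sublist (d # lx (Suc q) # lx q # cen q) (c # butlast (cen (Suc q)))"
    then have s: "sublist (lx (Suc q) # lx q # cen q) (butlast (cen (Suc q)))"
      by (rule sublist_Cons_tl)
    then obtain c' t where ct: "butlast (cen (Suc q)) = c' # t" by (cases "butlast (cen (Suc q))") (auto simp del: cen.simps)
    then have "sublist (lx q # cen q) t" using s sublist_Cons_tl by metis
    then have "sublist (cen q) t" by (meson sublist_order.order.trans sublist_Cons_right sublist_order.order.refl)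
    then show False using cen_not_sublist[OF q(2)] ct by (simp del: cen.simps)
  qed
  moreover have "length (cen (Suc q)) = Suc (length (butlast (cen (Suc q))))"
    by simp
  ultimately show ?thesis
    by (intro window_split_map[OF e]) (simp_all add: length_cen_Suc_Suc del: cen.simps)
qed

text \<open>Windows 0 and 1 consist of the positions 1 and 2 alone. There any two adjacent letters
  serve as the factor, since the prefix before them is shorter than two letters.\<close>

lemma fibw_mids:
  assumes w: "map \<tau> (expand R r) = w" "fibw N w" and "i \<le> N"
  shows "\<exists>m \<in> mids R r. rank m = i"
proof -
  consider "i = 0" | "i = 1" | q where "i = Suc (Suc q)" by (cases i rule: fib_word.cases) auto
  then show ?thesis
  proof cases
    case 1
    have "length w \<ge> 2" using w by (auto simp: fibw_def chw_def)
    then have "map \<tau> (expand R r) = [] @ take 2 w @ drop 2 w" "length (take 2 w) = 2" "take 2 w \<noteq> []" using w by auto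
    then have "\<exists>m\<in>mids R r. 1 \<le> m \<and> m \<le> 1"
      by (intro window_split_map[of \<tau> r "[]" "take 2 w" "drop 2 w"]) auto
    then obtain m where "m \<in> mids R r" "m \<le> 1" by blast
    then show ?thesis using 1 rank_0[of m] by (intro bexI[of _ m]) auto
  next
    case 2
    then have "N \<ge> 1" using assms by simp
    then have "length (cen N) \<ge> 1" using length_cen_ge[of N] by simp
    then have l: "length w \<ge> 3" using w by (auto simp: fibw_def chw_def)
    then have e: "map \<tau> (expand R r) = take 1 w @ take 2 (drop 1 w) @ drop 3 w" "length (take 2 (drop 1 w)) = 2"
      using w by (auto simp: drop_drop[symmetric] simp del: drop_drop) (metis One_nat_def append_take_drop_id drop_drop numeral_3_eq_3 one_add_one plus_1_eq_Suc take_add)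
    have "\<not> sublist (take 2 (drop 1 w)) (take 1 w)"
      using l sublist_length_le[of "take 2 (drop 1 w)" "take 1 w"] by auto
    then have "\<exists>m\<in>mids R r. 2 \<le> m \<and> m \<le> 2"
      by (rule window_split_map[OF e(1)]) (use e(2) l in auto)
    then have "2 \<in> mids R r" by (metis le_antisym)
    then show ?thesis using 2 rank_Suc[of 0 2] by (intro bexI[of _ 2]) auto
  next
    case (3 q)
    have "\<exists>m\<in>mids R r. length (cen (Suc q)) + 2 \<le> m \<and> m \<le> length (cen (Suc (Suc q))) + 1"
      using w fib_window[of \<tau> r N q] chw_window[of \<tau> r "lx (Suc N)" N q] 3 assms(3) le_SucI
      unfolding fibw_def chw_def by (metis Suc_eq_plus1)
    then show ?thesis using 3 rank_Suc[of "Suc q"] by (metis Suc_eq_plus1 less_Suc_eq_le add_2_eq_Suc')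
  qed
qed

section \<open>Counting binary rules by windows\<close>

lemma fibw_card_binaries:
  assumes "map \<tau> (expand R r) = w" "fibw N w"
  shows "Suc N \<le> card (binaries R r)"
proof -
  have "{..N} \<subseteq> (\<lambda>i. rank (mid R r i)) ` binaries R r"
    using fibw_mids[OF assms] by fastforce
  then have "card {..N} \<le> card (binaries R r)"
    by (meson card_image_le card_mono finite_binaries finite_imageI le_trans)
  then show ?thesis by simp
qed

lemma fibw_rank_mid_inj:
  assumes "map \<tau> (expand R r) = w" "fibw N w" "card (binaries R r) \<le> Suc N"
  shows "inj_on (\<lambda>i. rank (mid R r i)) (binaries R r)"
proof -
  have "{..N} \<subseteq> (\<lambda>i. rank (mid R r i)) ` binaries R r"
    using fibw_mids[OF assms(1,2)] by fastforce
  then have "card {..N} \<le> card ((\<lambda>i. rank (mid R r i)) ` binaries R r)"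
    by (meson card_mono finite_binaries finite_imageI)
  then have "card ((\<lambda>i. rank (mid R r i)) ` binaries R r) = card (binaries R r)"
    using assms(3) card_image_le[OF finite_binaries[of r], of "\<lambda>i. rank (mid R r i)"] by simp
  then show ?thesis by (rule eq_card_imp_inj_on[OF finite_binaries])
qed

text \<open>
  If the letter \<open>B\<close> can be isolated by two adjacent split points in a single place only, then a
  rule containing \<open>B\<close> has its leftmost occurrence there; two such rules would cross.
\<close>

lemma isolated_leaf_rule:
  assumes inj: "inj_on (mid R r) (binaries R r)"
    and B: "R B = None" "B \<in> set (expand R r)" "R r \<noteq> None"
    and iso: "\<And>p. p = 0 \<or> p \<in> mids R r \<Longrightarrow> Suc p = len R r \<or> Suc p \<in> mids R r \<Longrightarrow>
      p < len R r \<Longrightarrow> expand R r ! p = B \<Longrightarrow> p = c"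
  obtains Z j k where "Z \<in> binaries R r" "R Z = Some (j, k)"
    "\<And>X j k. X \<in> binaries R r \<Longrightarrow> R X = Some (j, k) \<Longrightarrow> j = B \<or> k = B \<Longrightarrow> X = Z"
    "(k = B \<and> first R r Z + len R Z = Suc c \<and>
        (\<forall>p < len R r. expand R r ! p = B \<longrightarrow> (\<exists>s. occ R r Z s \<and> s + len R Z = Suc p))) \<or>
     (j = B \<and> first R r Z = c \<and> (\<forall>p < len R r. expand R r ! p = B \<longrightarrow> occ R r Z p))"
proof -
  have eB: "expand R B = [B]" using B(1) by (rule expand_None)
  have right: "mid R r X = c \<and> first R r X + len R X = Suc c"
    if X: "X \<in> binaries R r" "R X = Some (j, B)" for X j
  proof -
    obtain s where "occ R r X s" using X by (auto simp: binaries_def)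
    then have f: "occ R r X (first R r X)" using first_occ by blast
    have m: "mid R r X = first R r X + len R j" using X(2) by (rule mid_Some)
    have e: "first R r X + len R X = Suc (mid R r X)" using X(2) eB m by (simp add: expand_Some)
    have "occ R r B (mid R r X)"
      using occ_trans[OF f occ_rightI[OF X(2) occ_self]] m by simp
    then have "mid R r X < len R r \<and> expand R r ! mid R r X = B"
      using occ_len[of r B "mid R r X"] occ_nth[of r B "mid R r X" 0] eB by simp
    then have "mid R r X = c" using iso[of "mid R r X"] first_end[OF f] e X(1) by auto
    then show ?thesis using e by simp
  qed
  have left: "first R r X = c \<and> mid R r X = Suc c"
    if X: "X \<in> binaries R r" "R X = Some (B, k)" for X k
  proof -
    obtain s where "occ R r X s" using X by (auto simp: binaries_def)
    then have f: "occ R r X (first R r X)" using first_occ by blast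
    have m: "mid R r X = Suc (first R r X)" using X(2) eB mid_Some by simp
    have "occ R r B (first R r X)"
      using occ_trans[OF f occ_leftI[OF X(2) occ_self]] m by simp
    then have "first R r X < len R r \<and> expand R r ! first R r X = B"
      using occ_len[of r B "first R r X"] occ_nth[of r B "first R r X" 0] eB by simp
    moreover have "Suc (first R r X) \<in> mids R r" using m X(1) by (metis imageI)
    ultimately show ?thesis using iso[of "first R r X"] first_start[OF f] m by auto
  qed
  have uniq: "X = X'" if X: "X \<in> binaries R r" "R X = Some (j, k)" "j = B \<or> k = B"
    and X': "X' \<in> binaries R r" "R X' = Some (j', k')" "j' = B \<or> k' = B" for X j k X' j' k'
  proof -
    have crossing: False if Y: "Y \<in> binaries R r" "R Y = Some (y, B)"
      and Y': "Y' \<in> binaries R r" "R Y' = Some (B, y')" for Y y Y' y'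
    proof -
      have occs: "occ R r Y (first R r Y)" "occ R r Y' (first R r Y')"
        using Y Y' first_occ by (auto simp: binaries_def)
      have l: "first R r Y + len R Y = Suc c" "first R r Y' = c" "mid R r Y = c"
        using right[OF Y] left[OF Y'] by auto
      have "first R r Y < c" using l(3) mid_Some[OF Y(2), of r] len_pos[of y] by linarith
      have "len R Y' \<ge> 2" using Y'(2) eB len_pos[of y'] by (simp add: expand_Some Suc_le_eq)
      have "occ R Y Y' (c - first R r Y)"
        using occ_laminar[OF occs] l \<open>first R r Y < c\<close> \<open>len R Y' \<ge> 2\<close> by auto
      then show False using occ_len l \<open>first R r Y < c\<close> \<open>len R Y' \<ge> 2\<close> by fastforce
    qed
    have "mid R r X = mid R r X'"
      using crossing right left X X' by metis
    then show ?thesis using inj X(1) X'(1) by (simp add: inj_on_def)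
  qed
  \<comment> \<open>Every occurrence of \<open>B\<close> is a child of some node, as
    \<open>B\<close> is not the root. Uniqueness turns this node into an occurrence of
    \<open>Z\<close>, so occurrences of \<open>Z\<close> are known wherever \<open>B\<close> stands
    in the word.\<close>
  have parent: "\<exists>X j k s. occ R r X s \<and> X \<in> binaries R r \<and> R X = Some (j, k) \<and>
      (B = j \<and> p = s \<or> B = k \<and> Suc p = s + len R X)"
    if p: "p < len R r" "expand R r ! p = B" for p
  proof -
    have "occ R r B p" using occ_leaf[OF p(1)] p(2) by simp
    moreover have "B \<noteq> r" using B by auto
    ultimately obtain q j k sq where "occ R r q sq" "R q = Some (j, k)"
      "B = j \<and> p = sq \<or> B = k \<and> p = sq + len R j" by (rule occ_child_cases)
    then show ?thesis using eB by (force simp: binaries_def expand_Some)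
  qed
  obtain p0 where p0: "p0 < len R r" "expand R r ! p0 = B"
    using B(2) by (auto simp: in_set_conv_nth)
  obtain Z j k where Z: "Z \<in> binaries R r" "R Z = Some (j, k)" "B = j \<or> B = k"
    using parent[OF p0] by blast
  have pZ: "\<exists>s. occ R r Z s \<and> (B = j \<and> p = s \<or> B = k \<and> Suc p = s + len R Z)"
    if p: "p < len R r" "expand R r ! p = B" for p
  proof -
    obtain X j' k' s where X: "occ R r X s" "X \<in> binaries R r" "R X = Some (j', k')"
      "B = j' \<and> p = s \<or> B = k' \<and> Suc p = s + len R X" using parent[OF p] by blast
    then have "X = Z" using uniq Z by metis
    then show ?thesis using X Z(2) by auto
  qed
  have not_both: "\<not> (j = B \<and> k = B)"
    using left[of Z k] right[of Z j] Z by auto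
  show ?thesis
  proof (rule that[OF Z(1,2)])
    show "X = Z" if "X \<in> binaries R r" "R X = Some (j, k)" "j = B \<or> k = B" for X j k
      using uniq[OF that Z(1,2)] Z(3) by auto
  next
    show "(k = B \<and> first R r Z + len R Z = Suc c \<and>
        (\<forall>p < len R r. expand R r ! p = B \<longrightarrow> (\<exists>s. occ R r Z s \<and> s + len R Z = Suc p))) \<or>
     (j = B \<and> first R r Z = c \<and> (\<forall>p < len R r. expand R r ! p = B \<longrightarrow> occ R r Z p))"
      using left[of Z k] right[of Z j] Z pZ not_both by metis
  qed
qed

end

section \<open>Isolated occurrences of \<open>Lb\<close> in the extremal case\<close>

lemma fib_word_begin:
  assumes "N \<ge> 2"
  obtains "cen N @ [lx N, lx (Suc N)] = [La, Lb, La, La, Lb]"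
  | z where "cen N @ [lx N, lx (Suc N)] = [La, Lb, La, La, Lb, La, Lb] @ z"
proof (cases "N = 2")
  case True
  have "cen 2 = [La, Lb, La]" by (simp add: numeral_2_eq_2)
  then show ?thesis using that(1) True by (simp add: lx_def)
next
  case False
  then have "3 \<le> N" using assms by simp
  then obtain z where "cen N @ [lx N] = cen 3 @ [lx 3] @ z" using cen_lx_prefix by blast
  then have "cen N @ [lx N, lx (Suc N)] = [La, Lb, La, La, Lb, La, Lb] @ z @ [lx (Suc N)]"
    by (simp add: lx_def numeral_3_eq_3)
  then show ?thesis by (rule that(2))
qed

lemma chw_begin_even:
  assumes "N \<ge> 2" "even N"
  shows "\<exists>z. chw N = [Lb, La, Lb, La, La] @ z"
proof -
  obtain z where z: "cen N @ [lx N] = cen 2 @ [lx 2] @ z" using cen_lx_prefix assms by blast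
  have "cen 2 = [La, Lb, La]" by (simp add: numeral_2_eq_2)
  then show ?thesis unfolding chw_def z using assms(2) by (simp add: lx_def)
qed

lemma chw_begin_odd:
  assumes "N \<ge> 2" "odd N"
  shows "\<exists>z. chw N = [La, La, Lb, La, La, Lb, La, Lb] @ z"
proof -
  have "3 \<le> N" using assms by (cases "N = 2") auto
  then obtain z where z: "cen N @ [lx N] = cen 3 @ [lx 3] @ z" using cen_lx_prefix by blast
  have "cen 3 = [La, Lb, La, La, Lb, La]" by (simp add: numeral_3_eq_3)
  then show ?thesis unfolding chw_def z using assms(2) by (simp add: lx_def)
qed

context acyclic_rules
begin

lemma mids_bounds:
  assumes "m \<in> mids R r"
  shows "0 < m \<and> m < len R r"
proof -
  obtain i j k where i: "i \<in> binaries R r" "R i = Some (j, k)" "m = mid R r i"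
    using assms by (force simp: binaries_def)
  then have "occ R r i (first R r i)" using first_occ by (auto simp: binaries_def)
  then have "first R r i + len R i \<le> len R r" by (rule occ_len)
  then show ?thesis using i(3) mid_Some[OF i(2), of r] len_Some[OF i(2)] len_pos[of j] len_pos[of k]
    by linarith
qed

text \<open>Adjacent split points belong to different windows, so the left one is the last position
  of its window. From position 3 on this is exactly what \<open>fib_window\<close> excludes; smaller
  positions are settled by reading off the letters.\<close>

lemma fib_isolated:
  assumes w: "map \<tau> (expand R r) = cen N @ [lx N, lx (Suc N)]" and N: "N \<ge> 2"
    and inj: "inj_on rank (mids R r)"
    and p: "p = 0 \<or> p \<in> mids R r" "Suc p = len R r \<or> Suc p \<in> mids R r" "\<tau> (expand R r ! p) = Lb"
      "p < len R r"
  shows "p = 1"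
proof -
  have l: "len R r = length (cen N) + 2" using w by (metis length_map length_append length_Cons list.size(3) One_nat_def Suc_1)
  have nth: "(cen N @ [lx N, lx (Suc N)]) ! p = Lb" using p w by (metis nth_map)
  obtain z where "cen N @ [lx N, lx (Suc N)] = [La, Lb, La] @ z"
    using fib_word_begin[OF N] by (metis append_Cons append_Nil)
  then have "p \<noteq> 0" "p \<noteq> 2" using nth by (metis append_Cons letter.distinct(1) nth_Cons_0, auto)
  moreover have False if p3: "p \<ge> 3"
  proof -
    have pm: "p \<in> mids R r" using p(1) p3 by simp
    obtain i where i: "length (cen i) + 2 \<le> p" "p < length (cen (Suc i)) + 2"
      using p3 by (cases p rule: rank_cases) auto
    have i0: "i \<noteq> 0" using i(2) p3 by (auto intro: Nat.gr0I)
    then obtain q where q: "i = Suc q" by (cases i) auto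
    have "i < N"
    proof (rule ccontr)
      assume "\<not> i < N"
      then have "length (cen N) \<le> length (cen i)" by (intro length_cen_mono) simp
      then show False using mids_bounds[OF pm] l i(1) by simp
    qed
    then obtain m where m: "m \<in> mids R r" "length (cen i) + 2 \<le> m" "m \<le> length (cen (Suc i))"
      using fib_window[OF w, of q] q by auto
    have "rank p = rank m" using rank_Suc[of i p] rank_Suc[of i m] i m by simp
    then have "p = m" using inj pm m(1) by (meson inj_onD)
    then have pi: "p \<le> length (cen (Suc i))" using m by simp
    have "Suc p \<noteq> len R r" using pi l length_cen_mono[of "Suc i" N] \<open>i < N\<close> by simp
    then have "Suc p \<in> mids R r" using p(2) by simp
    moreover have "rank (Suc p) = rank p" using rank_Suc[of i p] rank_Suc[of i "Suc p"] i pi by simp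
    ultimately show False using inj pm by (metis inj_onD n_not_Suc_n)
  qed
  ultimately show ?thesis by (cases "p \<ge> 3") auto
qed

text \<open>Beyond the beginning, \<open>p\<close> must be the last position of a window and
  \<open>Suc p\<close> the first of the next. The letter at such a place is
  \<open>lx (Suc i)\<close>, so it is \<open>Lb\<close> only for even \<open>i\<close>, and for
  these \<open>chw_even_window\<close> keeps the next split point away from the first position. At
  the end of the word the parity of \<open>N\<close> decides.\<close>

lemma chw_even_isolated:
  assumes w: "map \<tau> (expand R r) = chw N" and N: "N \<ge> 2" "even N"
    and inj: "inj_on rank (mids R r)"
    and p: "p = 0 \<or> p \<in> mids R r" "Suc p = len R r \<or> Suc p \<in> mids R r" "\<tau> (expand R r ! p) = Lb"
      "p < len R r"
  shows "p = 0"
proof -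
  have l: "len R r = length (cen N) + 2" using arg_cong[OF w, of length] by (simp add: chw_def)
  have nth: "chw N ! p = Lb" using p w by (metis nth_map)
  obtain z where "chw N = [Lb, La, Lb, La, La] @ z" using chw_begin_even N by blast
  then have "p \<noteq> 1" using nth by auto
  moreover have False if p2: "p \<ge> 2"
  proof -
    have pm: "p \<in> mids R r" using p(1) p2 by simp
    obtain i where i: "length (cen i) + 2 \<le> p" "p < length (cen (Suc i)) + 2"
      using p2 by (cases p rule: rank_cases) auto
    have "i < N"
    proof (rule ccontr)
      assume "\<not> i < N"
      then have "length (cen N) \<le> length (cen i)" by (intro length_cen_mono) simp
      then show False using mids_bounds[OF pm] l i(1) by simp
    qed
    have p_eq: "p = length (cen (Suc i)) + 1"
    proof (rule ccontr)
      assume "p \<noteq> length (cen (Suc i)) + 1"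
      then have small: "Suc p < length (cen (Suc i)) + 2" using i by simp
      then have "Suc p \<noteq> len R r" using l length_cen_mono[of "Suc i" N] \<open>i < N\<close> by simp
      then have "Suc p \<in> mids R r" using p(2) by simp
      moreover have "rank (Suc p) = rank p" using rank_Suc[of i p] rank_Suc[of i "Suc p"] i small by simp
      ultimately show False using inj pm by (metis inj_onD n_not_Suc_n)
    qed
    have "chw N ! p = lx (Suc i)"
    proof -
      obtain z' where "cen N @ [lx N] = cen (Suc i) @ [lx (Suc i)] @ z'"
        using cen_lx_prefix[of "Suc i" N] \<open>i < N\<close> by auto
      then show ?thesis unfolding chw_def p_eq by (simp add: nth_append del: cen.simps)
    qed
    then have "even i" using nth by (auto simp: lx_def split: if_splits)
    show False
    proof (cases "Suc i = N")
      case True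
      then show False using \<open>even i\<close> N by auto
    next
      case False
      then have iN: "Suc (Suc i) \<le> N" using \<open>i < N\<close> by simp
      have "map \<tau> (expand R r) = lx (Suc i) # cen N @ [lx N]"
        using w \<open>even i\<close> N by (simp add: chw_def lx_def)
      from chw_even_window[OF this iN] obtain m where m: "m \<in> mids R r"
        "length (cen (Suc i)) + 3 \<le> m" "m \<le> length (cen (Suc (Suc i))) + 1" by blast
      have "length (cen (Suc i)) < length (cen N)" using length_cen_less[of "Suc i"] length_cen_mono[OF iN] by linarith
      then have "Suc p \<in> mids R r" using p(2) p_eq l by auto
      moreover have "rank (Suc p) = rank m"
        using rank_Suc[of "Suc i" m] rank_Suc[of "Suc i" "Suc p"] p_eq m length_cen_less[of "Suc i"]
        by (simp del: cen.simps)
      ultimately have "Suc p = m" using inj m(1) by (meson inj_onD)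
      then show False using p_eq m by simp
    qed
  qed
  ultimately show ?thesis by (cases "p \<ge> 2") auto
qed

text \<open>The shifted range of \<open>chw_odd_window\<close> contains a split point. By induction
  it is not at the first position of the range, so it belongs to the new window, lies before its
  last position, and is the only split point there.\<close>

lemma chw_odd_mids:
  assumes w: "map \<tau> (expand R r) = chw N" and N: "N \<ge> 2" "odd N"
    and inj: "inj_on rank (mids R r)" and q: "Suc q < N"
  shows "length (cen (Suc (Suc q))) + 1 \<notin> mids R r"
  using q
proof (induction q)
  case 0
  obtain z where "chw N = [La, La, Lb, La, La, Lb, La, Lb] @ z" using chw_begin_odd N by blast
  \<comment> \<open>Window 2 consists of the positions 3 and 4. The factor \<open>Lb La\<close>
    after \<open>La La\<close> forces its split point to position 3.\<close>
  then have "map \<tau> (expand R r) = [La, La] @ [Lb, La] @ ([La, Lb, La, Lb] @ z)" using w by simp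
  then have "\<exists>m\<in>mids R r. 3 \<le> m \<and> m \<le> 3"
    by (rule window_split_map) (auto simp: sublist_Cons_right)
  then have "3 \<in> mids R r" by (metis le_antisym)
  moreover have "rank 3 = rank 4" using rank_Suc[of 1 3] rank_Suc[of 1 4] by simp
  ultimately have "4 \<notin> mids R r" using inj by (auto dest: inj_onD)
  then show ?case by (simp add: eval_nat_numeral)
next
  case (Suc q)
  then have IH: "length (cen (Suc (Suc q))) + 1 \<notin> mids R r" by simp
  have "\<exists>m\<in>mids R r. length (cen (Suc (Suc q))) + 1 \<le> m \<and> m \<le> length (cen (Suc (Suc (Suc q))))"
    by (rule chw_odd_window[OF w[unfolded chw_def]]) (use Suc in auto)
  then obtain m where m: "m \<in> mids R r" "length (cen (Suc (Suc q))) + 1 \<le> m"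
    "m \<le> length (cen (Suc (Suc (Suc q))))" by blast
  then have "length (cen (Suc (Suc q))) + 2 \<le> m" using IH by (cases "m = length (cen (Suc (Suc q))) + 1") auto
  then have "rank m = rank (length (cen (Suc (Suc (Suc q)))) + 1)"
    using rank_Suc[of "Suc (Suc q)"] m(3) by (simp del: cen.simps)
  then show ?case using inj m(1,3) by (metis inj_onD not_less_eq_eq Suc_eq_plus1 order_refl)
qed

lemma chw_odd_isolated:
  assumes w: "map \<tau> (expand R r) = chw N" and N: "N \<ge> 2" "odd N"
    and inj: "inj_on rank (mids R r)"
    and p: "p = 0 \<or> p \<in> mids R r" "Suc p = len R r \<or> Suc p \<in> mids R r" "\<tau> (expand R r ! p) = Lb"
      "p < len R r"
  shows "p = 2"
proof -
  have l: "len R r = length (cen N) + 2" using arg_cong[OF w, of length] by (simp add: chw_def)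
  have nth: "chw N ! p = Lb" using p w by (metis nth_map)
  obtain z where z: "chw N = [La, La, Lb, La, La, Lb, La, Lb] @ z" using chw_begin_odd N by blast
  then have "p \<noteq> 0" "p \<noteq> 1" using nth by (metis append_Cons letter.distinct(1) nth_Cons_0, auto)
  moreover have False if p3: "p \<ge> 3"
  proof -
    have pm: "p \<in> mids R r" using p(1) p3 by simp
    obtain i where i: "length (cen i) + 2 \<le> p" "p < length (cen (Suc i)) + 2"
      using p3 by (cases p rule: rank_cases) auto
    have i0: "i \<noteq> 0" using i(2) p3 by (auto intro: Nat.gr0I)
    then obtain q where q: "i = Suc q" by (cases i) auto
    have "i < N"
    proof (rule ccontr)
      assume "\<not> i < N"
      then have "length (cen N) \<le> length (cen i)" by (intro length_cen_mono) simp
      then show False using mids_bounds[OF pm] l i(1) by simp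
    qed
    have "p \<noteq> length (cen (Suc i)) + 1"
      using chw_odd_mids[OF w N inj, of q] q \<open>i < N\<close> pm by metis
    then have small: "Suc p < length (cen (Suc i)) + 2" using i by simp
    then have "Suc p \<noteq> len R r" using l length_cen_mono[of "Suc i" N] \<open>i < N\<close> by simp
    then have "Suc p \<in> mids R r" using p(2) by simp
    moreover have "rank (Suc p) = rank p" using rank_Suc[of i p] rank_Suc[of i "Suc p"] i small by simp
    ultimately show False using inj pm by (metis inj_onD n_not_Suc_n)
  qed
  ultimately show ?thesis by (cases "p \<ge> 3") auto
qed

section \<open>The rule that contains \<open>Lb\<close>\<close>

lemma binary_first_occ: "Z \<in> binaries R r \<Longrightarrow> occ R r Z (first R r Z)"
  using first_occ by (auto simp: binaries_def)

lemma len_ge_2: "R Z = Some (j, k) \<Longrightarrow> len R Z \<ge> 2"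
  using len_pos[of j] len_pos[of k] len_Some[of Z j k] by linarith

lemma len_2_rule:
  assumes "occ R r Z s" "len R Z = 2" "R Z = Some (j, k)"
  shows "j = expand R r ! s \<and> k = expand R r ! Suc s"
proof -
  have "len R j = 1 \<and> len R k = 1"
    using assms(2) len_Some[OF assms(3)] len_pos[of j] len_pos[of k] by linarith
  then have "expand R Z = [j, k]"
    using expand_Some[OF assms(3)] len_eq_1 expand_None by simp
  then show ?thesis using occ_nth[OF assms(1), of 0] occ_nth[OF assms(1), of 1] by simp
qed

text \<open>The rule found by \<open>isolated_leaf_rule\<close> has an occurrence at every
  \<open>Lb\<close>, always with \<open>Lb\<close> at the same end. Two nearby occurrences are
  disjoint, which bounds its length by two or three; length three is refuted by comparing letters at
  two occurrences.\<close>

lemma fibw_bigram_rule: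
  assumes w: "expand R r = map h w" "fibw N w" "N \<ge> 2" and h: "inj h"
    and card: "card (binaries R r) \<le> Suc N"
  obtains Z where "Z \<in> binaries R r" "R Z = Some (h La, h Lb) \<or> R Z = Some (h Lb, h La)"
    "\<And>X j k. X \<in> binaries R r \<Longrightarrow> R X = Some (j, k) \<Longrightarrow> j = h Lb \<or> k = h Lb \<Longrightarrow> X = Z"
proof -
  let ?\<tau> = "inv h"
  have \<tau>: "map ?\<tau> (expand R r) = w" using w(1) h by simp
  have inv: "inv h (h c) = c" for c using h by simp
  have "inj_on (\<lambda>i. rank (mid R r i)) (binaries R r)"
    using fibw_rank_mid_inj[OF \<tau> w(2) card] .
  then have inj: "inj_on (mid R r) (binaries R r)" "inj_on rank (mids R r)"
    using inj_on_imageI[of rank "mid R r"] by (auto simp: comp_def inj_on_def)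
  have nth: "expand R r ! p = h (w ! p)" if "p < length w" for p
    using w(1) that by simp
  have lw: "len R r = length w" using w(1) by simp
  have Lb: "expand R r ! p = h Lb \<longleftrightarrow> w ! p = Lb" if "p < length w" for p
    using nth[OF that] h by (auto dest: injD)
  have "length w \<ge> 2" "Lb \<in> set w"
    using w(2) by (auto simp: fibw_def chw_def lx_def)
  then have B: "R (h Lb) = None" "h Lb \<in> set (expand R r)"
    using w(1) expand_leaves[of "h Lb" r] by auto
  have Rr: "R r \<noteq> None"
  proof
    assume "R r = None"
    then have "len R r = 1" by (simp add: expand_None)
    then show False using lw \<open>length w \<ge> 2\<close> by simp
  qed
  consider (fib) "w = cen N @ [lx N, lx (Suc N)]" | (even) "w = chw N" "even N"
    | (odd) "w = chw N" "odd N" using w(2) by (auto simp: fibw_def)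
  then show ?thesis
  proof cases
    case fib
    have iso: "p = 1" if "p = 0 \<or> p \<in> mids R r" "Suc p = len R r \<or> Suc p \<in> mids R r"
      "p < len R r" "expand R r ! p = h Lb" for p
      using fib_isolated[OF \<tau>[unfolded fib] w(3) inj(2) that(1,2) _ that(3)] that(4) inv by simp
    obtain z where z: "w = [La, Lb, La, La, Lb] @ z" "z = [] \<or> (\<exists>z'. z = [La, Lb] @ z')"
      using fib_word_begin[OF w(3)] fib by (metis append_Cons append_Nil append_Nil2)
    obtain Z j k where Z: "Z \<in> binaries R r" "R Z = Some (j, k)"
      "\<And>X j k. X \<in> binaries R r \<Longrightarrow> R X = Some (j, k) \<Longrightarrow> j = h Lb \<or> k = h Lb \<Longrightarrow> X = Z"
      "(k = h Lb \<and> first R r Z + len R Z = Suc 1 \<and>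
        (\<forall>p < len R r. expand R r ! p = h Lb \<longrightarrow> (\<exists>s. occ R r Z s \<and> s + len R Z = Suc p))) \<or>
      (j = h Lb \<and> first R r Z = 1 \<and> (\<forall>p < len R r. expand R r ! p = h Lb \<longrightarrow> occ R r Z p))"
      using isolated_leaf_rule[OF inj(1) B Rr iso] by blast
    note occZ = binary_first_occ[OF Z(1)]
    from Z(4) show ?thesis
    proof (elim disjE conjE)
      assume e: "first R r Z + len R Z = Suc 1"
      then have "first R r Z = 0" "len R Z = 2" using len_ge_2[OF Z(2)] by auto
      then have "R Z = Some (h La, h Lb)"
        using len_2_rule[OF occZ _ Z(2)] nth z Z(2) by simp
      then show ?thesis using that Z by blast
    next
      assume e: "first R r Z = 1" "\<forall>p < len R r. expand R r ! p = h Lb \<longrightarrow> occ R r Z p"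
      have o4: "occ R r Z 4" using e(2) lw nth[of 4] z by simp
      then have "len R Z \<le> 3" using occ_same_disjoint[OF occZ, of 4] e(1) by simp
      moreover have "len R Z \<noteq> 3"
      proof
        assume l3: "len R Z = 3"
        \<comment> \<open>The occurrence at position 4 has to fit, which excludes the word of length
          five. In longer words \<open>Lb La La\<close> at position 1 and \<open>Lb La Lb\<close> at
          position 4 would be the same expansion.\<close>
        have "4 + len R Z \<le> length w" using occ_len[OF o4] lw by simp
        then obtain z' where z': "z = [La, Lb] @ z'" using l3 z by auto
        have "expand R r ! (1 + 2) = expand R r ! (4 + 2)"
          using occ_nth[OF occZ, of 2] occ_nth[OF o4, of 2] l3 e(1) by simp
        then show False using nth[of 3] nth[of 6] z z' injD[OF h, of La Lb] by (auto simp: numeral_3_eq_3)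
      qed
      ultimately have "len R Z = 2" using len_ge_2[OF Z(2)] by simp
      then have "R Z = Some (h Lb, h La)"
        using len_2_rule[OF occZ _ Z(2)] nth[of 1] nth[of 2] z Z(2) e(1) by (simp add: numeral_2_eq_2)
      then show ?thesis using that Z by blast
    qed
  next
    case even
    have iso: "p = 0" if "p = 0 \<or> p \<in> mids R r" "Suc p = len R r \<or> Suc p \<in> mids R r"
      "p < len R r" "expand R r ! p = h Lb" for p
      using chw_even_isolated[OF \<tau>[unfolded even(1)] w(3) even(2) inj(2) that(1,2) _ that(3)] that(4) inv by simp
    obtain z where z: "w = [Lb, La, Lb, La, La] @ z" using chw_begin_even[OF w(3)] even by auto
    obtain Z j k where Z: "Z \<in> binaries R r" "R Z = Some (j, k)"
      "\<And>X j k. X \<in> binaries R r \<Longrightarrow> R X = Some (j, k) \<Longrightarrow> j = h Lb \<or> k = h Lb \<Longrightarrow> X = Z"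
      "(k = h Lb \<and> first R r Z + len R Z = Suc 0 \<and>
        (\<forall>p < len R r. expand R r ! p = h Lb \<longrightarrow> (\<exists>s. occ R r Z s \<and> s + len R Z = Suc p))) \<or>
      (j = h Lb \<and> first R r Z = 0 \<and> (\<forall>p < len R r. expand R r ! p = h Lb \<longrightarrow> occ R r Z p))"
      using isolated_leaf_rule[OF inj(1) B Rr iso] by blast
    note occZ = binary_first_occ[OF Z(1)]
    from Z(4) len_ge_2[OF Z(2)] have e: "first R r Z = 0"
      "\<forall>p < len R r. expand R r ! p = h Lb \<longrightarrow> occ R r Z p" by auto
    have "occ R r Z 2" using e(2) lw nth[of 2] z by simp
    then have "len R Z = 2" using occ_same_disjoint[OF occZ, of 2] e(1) len_ge_2[OF Z(2)] by simp
    then have "R Z = Some (h Lb, h La)"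
      using len_2_rule[OF occZ _ Z(2)] nth[of 0] nth[of 1] z Z(2) e(1) by simp
    then show ?thesis using that Z by blast
  next
    case odd
    have iso: "p = 2" if "p = 0 \<or> p \<in> mids R r" "Suc p = len R r \<or> Suc p \<in> mids R r"
      "p < len R r" "expand R r ! p = h Lb" for p
      using chw_odd_isolated[OF \<tau>[unfolded odd(1)] w(3) odd(2) inj(2) that(1,2) _ that(3)] that(4) inv by simp
    obtain z where z: "w = [La, La, Lb, La, La, Lb, La, Lb] @ z" using chw_begin_odd[OF w(3)] odd by auto
    obtain Z j k where Z: "Z \<in> binaries R r" "R Z = Some (j, k)"
      "\<And>X j k. X \<in> binaries R r \<Longrightarrow> R X = Some (j, k) \<Longrightarrow> j = h Lb \<or> k = h Lb \<Longrightarrow> X = Z"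
      "(k = h Lb \<and> first R r Z + len R Z = Suc 2 \<and>
        (\<forall>p < len R r. expand R r ! p = h Lb \<longrightarrow> (\<exists>s. occ R r Z s \<and> s + len R Z = Suc p))) \<or>
      (j = h Lb \<and> first R r Z = 2 \<and> (\<forall>p < len R r. expand R r ! p = h Lb \<longrightarrow> occ R r Z p))"
      using isolated_leaf_rule[OF inj(1) B Rr iso] by blast
    note occZ = binary_first_occ[OF Z(1)]
    from Z(4) show ?thesis
    proof (elim disjE conjE)
      assume e: "first R r Z + len R Z = Suc 2" "\<forall>p < len R r. expand R r ! p = h Lb \<longrightarrow>
        (\<exists>s. occ R r Z s \<and> s + len R Z = Suc p)"
      obtain s where s: "occ R r Z s" "s + len R Z = 6" using e(2)[rule_format, of 5] lw nth[of 5] z by auto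
      obtain t where t: "occ R r Z t" "t + len R Z = 8" using e(2)[rule_format, of 7] lw nth[of 7] z by auto
      have "len R Z \<le> 2" using occ_same_disjoint[OF s(1) t(1)] s t by simp
      then have "len R Z = 2" "first R r Z = 1" using len_ge_2[OF Z(2)] e(1) by auto
      then have "R Z = Some (h La, h Lb)"
        using len_2_rule[OF occZ _ Z(2)] nth[of 1] nth[of 2] z Z(2) by (simp add: numeral_2_eq_2)
      then show ?thesis using that Z by blast
    next
      assume e: "first R r Z = 2" "\<forall>p < len R r. expand R r ! p = h Lb \<longrightarrow> occ R r Z p"
      have o5: "occ R r Z 5" using e(2) lw nth[of 5] z by simp
      then have "len R Z \<le> 3" using occ_same_disjoint[OF occZ, of 5] e(1) by simp
      moreover have "len R Z \<noteq> 3"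
      proof
        assume l3: "len R Z = 3"
        have "expand R r ! (2 + 2) = expand R r ! (5 + 2)"
          using occ_nth[OF occZ, of 2] occ_nth[OF o5, of 2] l3 e(1) by simp
        then show False using nth[of 4] nth[of 7] z inv by (auto dest: injD[OF h])
      qed
      \<comment> \<open>A rule \<open>Lb La\<close> at position 2 would end at position 4, the last
        of its window, where no split point is possible. So an odd Christoffel word, which ends in
        \<open>Lb\<close>, admits only the rule \<open>La Lb\<close>.\<close>
      ultimately have "len R Z = 2" using len_ge_2[OF Z(2)] by simp
      then have "4 \<in> mids R r" using first_end[OF occZ] e(1) lw z by auto
      moreover have "length (cen (Suc (Suc 0))) + 1 = 4" by simp
      moreover have "Suc 0 < N" using w(3) by simp
      ultimately show ?thesis
        using chw_odd_mids[OF \<tau>[unfolded odd(1)] w(3) odd(2) inj(2), of 0] by metis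
    qed
  qed
qed

end

section \<open>Contracting a bigram\<close>

lemma set_subset_range_map: "set xs \<subseteq> range f \<Longrightarrow> \<exists>v. xs = map f v"
  by (simp add: ex_map_conv subset_iff image_iff)

context acyclic_rules
begin

lemma acyclic_contract: "acyclic_rules (R(Z := None))"
  using acyclic by (auto simp: acyclic_rules_def split: if_splits)

lemma occ_contract: "occ (R(Z := None)) r i s \<Longrightarrow> \<exists>s. occ R r i s"
proof (induction rule: occ.induct)
  case (occ_left r j k i s)
  then show ?case using occ_leftI[of r j k] by (auto split: if_splits)
next
  case (occ_right r j k i s)
  then show ?case using occ_rightI[of r j k] by (metis fun_upd_apply option.distinct(1))
qed (use occ_self in blast)

lemma binaries_contract: "binaries (R(Z := None)) r \<subseteq> binaries R r - {Z}"
  using occ_contract by (auto simp: binaries_def)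

lemma expand_contract:
  assumes Z: "R Z = Some (j, k)" "R j = None" "R k = None"
  shows "expand R i = concat (map (\<lambda>x. if x = Z then [j, k] else [x]) (expand (R(Z := None)) i))"
proof -
  interpret R': acyclic_rules "R(Z := None)" by (rule acyclic_contract)
  show ?thesis
  proof (induction i rule: R'.rules_induct)
    case (None i)
    have "expand R i = [j, k]" if "i = Z" using that Z by (simp add: expand_None expand_Some)
    moreover have "expand R i = [i]" if "i \<noteq> Z" using that None by (simp add: expand_None)
    ultimately show ?case using R'.expand_None[OF None] by (simp del: fun_upd_apply)
  next
    case (Some i j' k')
    then have "R i = Some (j', k')" by (auto split: if_splits)
    then show ?case using Some(2,3) R'.expand_Some[OF Some(1)] by (simp add: expand_Some del: fun_upd_apply)
  qed
qed

text \<open>Each leaf \<open>B\<close> hangs below \<open>Z\<close>, and after the contraction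
  \<open>Z\<close> is itself a leaf.\<close>

lemma expand_contract_notin:
  assumes B: "R B = None" "B \<noteq> r" "B \<noteq> Z"
    and uniq: "\<And>X j k. X \<in> binaries R r \<Longrightarrow> R X = Some (j, k) \<Longrightarrow> j = B \<or> k = B \<Longrightarrow> X = Z"
  shows "B \<notin> set (expand (R(Z := None)) r)"
proof -
  interpret R': acyclic_rules "R(Z := None)" by (rule acyclic_contract)
  have "B \<notin> set (expand (R(Z := None)) i)" if "occ R r i s" "B \<noteq> i" for i s
    using that
  proof (induction i arbitrary: s rule: R'.rules_induct)
    case (None i)
    then show ?case using R'.expand_None[OF None(1)] None(3) by (simp del: fun_upd_apply)
  next
    case (Some i j k)
    then have i: "R i = Some (j, k)" "i \<noteq> Z" by (auto split: if_splits)
    then have "i \<in> binaries R r" using Some by (auto simp: binaries_def)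
    then have "B \<noteq> j" "B \<noteq> k" using uniq i by blast+
    moreover have "occ R r j (s + 0)" "occ R r k (s + (len R j + 0))"
      using occ_trans[OF Some(4)] occ_leftI[OF i(1) occ_self] occ_rightI[OF i(1) occ_self] by blast+
    ultimately show ?case using Some(2,3) R'.expand_Some[OF Some(1)] by (auto simp del: fun_upd_apply)
  qed
  then show ?thesis using occ_self B by blast
qed

text \<open>All letters \<open>Lb\<close> are absorbed by \<open>Z\<close>, so only \<open>Z\<close>
  and \<open>h La\<close> remain. \<open>Z\<close> takes the role of \<open>La\<close>, and the old
  \<open>La\<close> takes that of \<open>Lb\<close>; with these roles the expansion of
  \<open>Z\<close> is \<open>phi\<close> or \<open>psi\<close>, depending on the order of
  \<open>c\<close> and \<open>d\<close>.\<close>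

lemma contract_bigram:
  assumes w: "expand R r = map h w" and h: "inj h" and r: "R r \<noteq> None" "set w = UNIV"
    and Z: "R Z = Some (h c, h d)" "{c, d} = UNIV"
    and uniq: "\<And>X j k. X \<in> binaries R r \<Longrightarrow> R X = Some (j, k) \<Longrightarrow> j = h Lb \<or> k = h Lb \<Longrightarrow> X = Z"
  obtains v where "expand (R(Z := None)) r = map (case_letter Z (h La)) v"
    "w = concat (map (case_letter [c, d] [La]) v)"
proof -
  have leaf: "R (h e) = None" for e using expand_leaves[of "h e" r] w r by auto
  have "Z \<noteq> h e" for e using Z leaf[of e] by auto
  have "set (expand (R(Z := None)) r) \<subseteq> range (case_letter Z (h La))"
  proof
    fix x assume x: "x \<in> set (expand (R(Z := None)) r)"
    have "h Lb \<notin> set (expand (R(Z := None)) r)"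
      by (rule expand_contract_notin) (use leaf r \<open>Z \<noteq> h Lb\<close> uniq in auto)
    then have "x \<noteq> h Lb" using x by auto
    have "x = Z \<or> x \<in> set (expand R r)"
      using x unfolding expand_contract[OF Z(1) leaf leaf, of r] by auto
    then have "x = Z \<or> x = h La" using w \<open>x \<noteq> h Lb\<close> by (auto, metis letter.exhaust)
    then show "x \<in> range (case_letter Z (h La))" by (metis letter.simps(3,4) rangeI)
  qed
  then obtain v where v: "expand (R(Z := None)) r = map (case_letter Z (h La)) v"
    using set_subset_range_map by blast
  have "map h w = concat (map (\<lambda>x. if x = Z then [h c, h d] else [x]) (map (case_letter Z (h La)) v))"
    using expand_contract[OF Z(1) leaf leaf, of r] w v by simp
  also have "\<dots> = map h (concat (map (case_letter [c, d] [La]) v))"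
    using \<open>Z \<noteq> h La\<close> by (induction v) (auto split: letter.splits)
  finally have "w = concat (map (case_letter [c, d] [La]) v)"
    using h by (simp add: inj_map_eq_map)
  then show ?thesis using that v by blast
qed

end

lemma phi_concat: "phi v = concat (map (case_letter [La, Lb] [La]) v)"
  by (induction v rule: phi.induct) auto

lemma psi_concat: "psi v = concat (map (case_letter [Lb, La] [La]) v)"
  by (induction v rule: psi.induct) auto

section \<open>Most frequent bigrams\<close>

lemma finite_bigram_occs [simp]: "finite (bigram_occs s x y)"
  by (rule finite_subset[of _ "{..<length s}"]) (auto simp: bigram_occs_def)

lemma finite_bigram_sets:
  "finite (card ` {S. S \<subseteq> bigram_occs s x y \<and> (\<forall>i\<in>S. Suc i \<notin> S)})"
  by (rule finite_imageI, rule finite_subset[of _ "Pow (bigram_occs s x y)"]) auto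

lemma bigram_freq_le: "bigram_freq s x y \<le> card (bigram_occs s x y)"
  unfolding bigram_freq_def
proof (subst Max_le_iff[OF finite_bigram_sets])
  show "card ` {S. S \<subseteq> bigram_occs s x y \<and> (\<forall>i\<in>S. Suc i \<notin> S)} \<noteq> {}" by blast
qed (auto intro: card_mono)

lemma bigram_freq_eq:
  assumes "x \<noteq> y"
  shows "bigram_freq s x y = card (bigram_occs s x y)"
proof (rule antisym[OF bigram_freq_le])
  have "bigram_occs s x y \<in> {S. S \<subseteq> bigram_occs s x y \<and> (\<forall>i\<in>S. Suc i \<notin> S)}"
    using assms by (auto simp: bigram_occs_def)
  then show "card (bigram_occs s x y) \<le> bigram_freq s x y"
    unfolding bigram_freq_def by (intro Max_ge[OF finite_bigram_sets]) blast
qed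

lemma bigram_freq_short:
  assumes "length s \<le> 3"
  shows "bigram_freq s x y < 2"
proof -
  have "card S \<le> 1" if S: "S \<subseteq> bigram_occs s x y" "\<forall>i\<in>S. Suc i \<notin> S" for S
  proof -
    have "S \<subseteq> {0, 1}" using S(1) assms by (auto simp: bigram_occs_def)
    then have "S \<subseteq> {0} \<or> S \<subseteq> {1}" using S(2) by auto
    then show ?thesis by (auto dest: subset_singletonD)
  qed
  then have "bigram_freq s x y \<le> 1"
    unfolding bigram_freq_def by (subst Max_le_iff[OF finite_bigram_sets]) blast+
  then show ?thesis by simp
qed

lemma bigram_occs_map: "inj g \<Longrightarrow> bigram_occs (map g w) (g c) (g d) = bigram_occs w c d"
  by (auto simp: bigram_occs_def dest: injD)

lemma bigram_freq_map: "inj g \<Longrightarrow> bigram_freq (map g w) (g c) (g d) = bigram_freq w c d"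
  by (simp add: bigram_freq_def bigram_occs_map)

lemma bigram_freq_posD:
  assumes "bigram_freq s x y > 0"
  shows "x \<in> set s \<and> y \<in> set s"
proof -
  have "bigram_occs s x y \<noteq> {}" using assms bigram_freq_le[of s x y] by auto
  then show ?thesis by (auto simp: bigram_occs_def)
qed

lemma fibw_ends:
  assumes "fibw (Suc N) w"
  shows "hd w = La \<or> last w = La"
proof -
  have "cen (Suc N) = La # psi (cen N)" by (simp add: phi_psi)
  then show ?thesis using assms by (cases "even N") (auto simp: fibw_def chw_def lx_def simp del: cen.simps)
qed

lemma fibw_no_LbLb:
  assumes "fibw (Suc N) w"
  shows "bigram_occs w Lb Lb = {}"
proof -
  have phi: "successively (\<lambda>x y. \<not> (x = Lb \<and> y = Lb)) (phi v)" for v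
  proof (induction v rule: phi.induct)
    case (2 v)
    then show ?case using phi_hd[of v] by (cases "phi v") auto
  next
    case (3 v)
    then show ?case by (cases "phi v") auto
  qed auto
  have psi: "successively (\<lambda>x y. \<not> (x = Lb \<and> y = Lb)) (psi v)" for v
  proof -
    have "successively (\<lambda>x y. \<not> (x = Lb \<and> y = Lb)) (La # psi v)"
      using phi[of v] unfolding phi_psi[symmetric] by (simp add: successively_append_iff)
    then show ?thesis by (cases "psi v") auto
  qed
  have "hd w = La \<or> last w = La" using fibw_ends assms .
  then obtain v where "w = phi v \<or> w = psi v"
    using fibw_phi[OF assms] fibw_psi[OF assms] by blast
  then have "successively (\<lambda>x y. \<not> (x = Lb \<and> y = Lb)) w" using phi psi by auto
  then show ?thesis by (auto simp: successively_conv_nth bigram_occs_def)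
qed

lemma count_list_conv_card: "count_list xs c = card {i. i < length xs \<and> xs ! i = c}"
  by (simp add: count_list_eq_length_filter length_filter_conv_card eq_commute)

lemma count_list_phi: "count_list (phi w) La = length w" "count_list (phi w) Lb = count_list w La"
  by (induction w rule: phi.induct) auto

lemma length_count_letter: "length w = count_list w La + count_list w Lb"
proof (induction w)
  case (Cons c w)
  then show ?case by (cases c) auto
qed simp

text \<open>The second bound keeps \<open>La La\<close> behind the mixed bigrams. Since
  \<open>phi\<close> turns lengths into numbers of \<open>La\<close> and numbers of
  \<open>La\<close> into numbers of \<open>Lb\<close>, it is the first bound for the preceding
  word.\<close>

lemma count_cen:
  "count_list (cen (Suc N)) Lb < count_list (cen (Suc N)) La"
  "count_list (cen (Suc (Suc N))) La < 2 * count_list (cen (Suc (Suc N))) Lb + 1"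
proof -
  show *: "count_list (cen (Suc N)) Lb < count_list (cen (Suc N)) La" for N
    by (simp add: count_list_phi length_count_letter)
  show "count_list (cen (Suc (Suc N))) La < 2 * count_list (cen (Suc (Suc N))) Lb + 1"
    using *[of N] by (subst (1 2) cen.simps(2)) (simp add: count_list_phi length_count_letter del: cen.simps)
qed

text \<open>Each \<open>Lb\<close> has neighbours \<open>La\<close>, so a mixed bigram occurs once
  per \<open>Lb\<close>, except that an \<open>Lb\<close> at an end of the word lacks one neighbour.
  One end is always \<open>La\<close>; hence the maximum is the number of \<open>Lb\<close>, and
  \<open>La La\<close> stays below it.\<close>

lemma fibw_max_bigram:
  assumes w: "fibw N w" "N \<ge> 2"
  shows "bigram_freq w c d \<ge> 2 \<and> (\<forall>c' d'. bigram_freq w c' d' \<le> bigram_freq w c d) \<longleftrightarrow>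
    c = La \<and> d = Lb \<and> hd w = La \<or> c = Lb \<and> d = La \<and> last w = La"
proof -
  obtain M where M: "N = Suc (Suc M)" using w(2) by (metis Suc_le_D numeral_2_eq_2 Suc_le_mono)
  have noLb: "bigram_occs w Lb Lb = {}" using fibw_no_LbLb w M by blast
  have wne: "w \<noteq> []" using w(1) by (auto simp: fibw_def chw_def)
  let ?a = "count_list w La" and ?b = "count_list w Lb"
  have ends: "hd w = La \<or> last w = La"
    using w(1) fibw_ends M by blast
  have counts: "?a < 2 * ?b" "?b \<ge> 2"
  proof -
    have "?a = Suc (count_list (cen N) La)" "?b = Suc (count_list (cen N) Lb)"
      using w(1) by (auto simp: fibw_def chw_def lx_def)
    moreover have "count_list (cen N) Lb \<ge> 1"
    proof -
      have "count_list (cen N) Lb = count_list (cen (Suc M)) La"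
        unfolding M by (subst cen.simps(2)) (simp add: count_list_phi del: cen.simps)
      then show ?thesis using count_cen(1)[of M] by linarith
    qed
    ultimately show "?a < 2 * ?b" "?b \<ge> 2" using count_cen(2)[of M] M by auto
  qed
  have "\<And>i. Suc i < length w \<Longrightarrow> w ! Suc i = Lb \<Longrightarrow> w ! i = La"
    using noLb by (auto simp: bigram_occs_def) (metis letter.exhaust)
  then have "bigram_occs w La Lb = {i. i < length (tl w) \<and> tl w ! i = Lb}"
    by (auto simp: bigram_occs_def nth_tl)
  then have ab: "bigram_freq w La Lb = count_list (tl w) Lb"
    by (simp add: bigram_freq_eq count_list_conv_card)
  have "\<And>i. Suc i < length w \<Longrightarrow> w ! i = Lb \<Longrightarrow> w ! Suc i = La"
    using noLb by (auto simp: bigram_occs_def) (metis letter.exhaust)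
  then have "bigram_occs w Lb La = {i. i < length (butlast w) \<and> butlast w ! i = Lb}"
    by (auto simp: bigram_occs_def nth_butlast less_diff_conv)
  then have ba: "bigram_freq w Lb La = count_list (butlast w) Lb"
    by (simp add: bigram_freq_eq count_list_conv_card)
  \<comment> \<open>Every \<open>La\<close> except one at the very end starts either
    \<open>La La\<close> or \<open>La Lb\<close>. As occurrences of \<open>La La\<close> may
    overlap, this bounds its frequency only from above.\<close>
  have "bigram_occs w La La \<union> bigram_occs w La Lb = {i. i < length (butlast w) \<and> butlast w ! i = La}"
    by (auto simp: bigram_occs_def nth_butlast less_diff_conv) (metis letter.exhaust)
  moreover have "bigram_occs w La La \<inter> bigram_occs w La Lb = {}"
    by (auto simp: bigram_occs_def)
  ultimately have "card (bigram_occs w La La) + card (bigram_occs w La Lb) = count_list (butlast w) La"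
    by (metis card_Un_disjoint count_list_conv_card finite_bigram_occs)
  then have aa: "bigram_freq w La La + count_list (tl w) Lb \<le> count_list (butlast w) La"
    using ab bigram_freq_le[of w La La] by (simp add: bigram_freq_eq)
  have bb: "bigram_freq w Lb Lb = 0" using noLb bigram_freq_le[of w Lb Lb] by simp
  have tl: "count_list (tl w) Lb = (if hd w = La then ?b else ?b - 1)"
    using wne by (cases w) (auto, metis letter.exhaust)
  have bl: "count_list (butlast w) c = (if last w = c then count_list w c - 1 else count_list w c)" for c
    using wne by (cases w rule: rev_exhaust) auto
  have la: "count_list w La > 0" using ends wne by (metis count_list_0_iff gr0I hd_in_set last_in_set)
  have ab': "bigram_freq w La Lb = (if hd w = La then ?b else ?b - 1)" using ab tl by simp
  have ba': "bigram_freq w Lb La = (if last w = La then ?b else ?b - 1)"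
    using ba bl[of Lb] by (cases "last w") auto
  have aa': "bigram_freq w La La < ?b"
    using aa tl bl[of La] counts ends la by (auto split: if_splits)
  have all: "(\<forall>c' d'. P c' d') \<longleftrightarrow> P La La \<and> P La Lb \<and> P Lb La \<and> P Lb Lb" for P
    by (metis letter.exhaust)
  show ?thesis unfolding all using ab' ba' aa' bb counts ends
    by (cases c; cases d) (auto split: if_splits)
qed

lemma replace_phi:
  assumes "inj g"
  shows "replace_bigram (g La) (g Lb) z (map g (phi v)) = map (case_letter z (g La)) v"
proof (induction v rule: phi.induct)
  case (3 v)
  have "g La \<noteq> g Lb" using assms by (auto dest: injD)
  then show ?case using 3 phi_hd[of v] by (cases "phi v") auto
qed auto

lemma replace_psi:
  assumes "inj g"
  shows "replace_bigram (g Lb) (g La) z (map g (psi v)) = map (case_letter z (g La)) v"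
proof (induction v rule: psi.induct)
  case (3 v)
  have "g La \<noteq> g Lb" using assms by (auto dest: injD)
  then show ?case using 3 by (cases "psi v") auto
qed auto

section \<open>Grammars of Fibonacci words\<close>

definition rules_of :: "'t slp \<Rightarrow> rules" where
  "rules_of G i = (if i < length G then case G ! i of Term c \<Rightarrow> None | Bin j k \<Rightarrow> Some (j, k) else None)"

definition terminal_of :: "'t slp \<Rightarrow> nat \<Rightarrow> 't" where
  "terminal_of G i = (case G ! i of Term c \<Rightarrow> c)"

lemma rules_of_Some: "rules_of G i = Some (j, k) \<longleftrightarrow> i < length G \<and> G ! i = Bin j k"
  by (auto simp: rules_of_def split: rhs.splits)

lemma acyclic_rules_of: "wf_slp G \<Longrightarrow> acyclic_rules (rules_of G)"
  by (simp add: acyclic_rules_def rules_of_Some wf_slp_def)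

lemma derivation_yield:
  assumes "wf_slp G"
  shows "derivation G i t \<Longrightarrow> yield t = map (terminal_of G) (expand (rules_of G) i)"
proof (induction rule: derivation.induct)
  interpret acyclic_rules "rules_of G" using acyclic_rules_of[OF assms] .
  case (Leaf i c)
  then have "rules_of G i = None" by (simp add: rules_of_def)
  then show ?case using Leaf by (simp add: expand_None terminal_of_def)
next
  interpret acyclic_rules "rules_of G" using acyclic_rules_of[OF assms] .
  case (Node i j k l r)
  then have "rules_of G i = Some (j, k)" by (simp add: rules_of_Some)
  then show ?case using Node by (simp add: expand_Some)
qed

lemma fibw_letters: "fibw N w \<Longrightarrow> set w = UNIV"
  by (auto simp: fibw_def chw_def lx_def) (metis letter.exhaust)+

lemma fibw_length: "fibw N w \<Longrightarrow> length w = length (cen N) + 2"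
  by (auto simp: fibw_def chw_def)

lemma grammar_size_split:
  assumes G: "grammar_of w G"
  defines "R \<equiv> rules_of G"
  shows "map (terminal_of G) (expand R (start G)) = w"
    and "card (binaries R (start G)) + card (set (expand R (start G))) \<le> length G"
    and "\<And>i. i \<in> set (expand R (start G)) \<Longrightarrow> i < length G \<and> G ! i = Term (terminal_of G i)"
proof -
  have wf: "wf_slp G" using G by (simp add: grammar_of_def)
  interpret acyclic_rules R unfolding R_def using acyclic_rules_of[OF wf] .
  have ne: "start G < length G" using wf by (auto simp: wf_slp_def start_def)
  show "map (terminal_of G) (expand R (start G)) = w"
    using G derivation_yield[OF wf] by (auto simp: grammar_of_def R_def)
  have le: "i < length G" if "occ R (start G) i s" for i s
    using occ_le[OF that] ne by simp
  have lt: "i < length G" if "i \<in> set (expand R (start G))" for i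
    using that occ_leaf le by (metis in_set_conv_nth)
  show "i < length G \<and> G ! i = Term (terminal_of G i)" if "i \<in> set (expand R (start G))" for i
    using expand_leaves[OF that] lt[OF that]
    by (auto simp: R_def rules_of_def terminal_of_def split: rhs.splits)
  have "binaries R (start G) \<inter> set (expand R (start G)) = {}"
    using expand_leaves by (auto simp: binaries_def)
  then have "card (binaries R (start G)) + card (set (expand R (start G))) =
      card (binaries R (start G) \<union> set (expand R (start G)))"
    by (simp add: card_Un_disjoint)
  also have "\<dots> \<le> card {..<length G}"
    by (rule card_mono) (use lt le in \<open>auto simp: binaries_def\<close>)
  finally show "card (binaries R (start G)) + card (set (expand R (start G))) \<le> length G" by simp
qed

lemma card_UNIV_letter: "card (UNIV :: letter set) = 2" "finite (UNIV :: letter set)"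
proof -
  have "(UNIV :: letter set) = {La, Lb}" by (auto intro: letter.exhaust)
  then show "card (UNIV :: letter set) = 2" "finite (UNIV :: letter set)"
    by (metis card_2_iff letter.distinct(1), metis finite.simps)
qed

text \<open>To the \<open>N + 1\<close> binary rules come terminal rules for two letters. In general
  several non-terminals may produce the same letter, but at size \<open>N + 3\<close> none is left
  over, so the leaves spell the word under an injective naming \<open>h\<close>.\<close>

lemma fibw_grammar_size:
  assumes G: "grammar_of w G" and w: "fibw N w"
  shows "N + 3 \<le> length G"
    and "length G \<le> N + 3 \<Longrightarrow> \<exists>h. inj h \<and> expand (rules_of G) (start G) = map h w \<and>
      card (binaries (rules_of G) (start G)) \<le> Suc N \<and> (\<forall>c. h c < length G \<and> G ! h c = Term c)"
proof -
  let ?R = "rules_of G" and ?r = "start G"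
  let ?T = "set (expand ?R ?r)"
  interpret acyclic_rules ?R using G acyclic_rules_of by (auto simp: grammar_of_def)
  note s = grammar_size_split[OF G]
  have bin: "Suc N \<le> card (binaries ?R ?r)" by (rule fibw_card_binaries[OF s(1) w])
  have im: "terminal_of G ` ?T = UNIV" using s(1) fibw_letters[OF w] by (metis set_map)
  then have T: "2 \<le> card ?T" using card_image_le[of ?T "terminal_of G"] card_UNIV_letter by simp
  show "N + 3 \<le> length G" using s(2) bin T by simp
  assume "length G \<le> N + 3"
  then have "card ?T = 2" "card (binaries ?R ?r) \<le> Suc N" using s(2) bin T by auto
  then have inj: "inj_on (terminal_of G) ?T"
    using im card_UNIV_letter by (intro eq_card_imp_inj_on) simp_all
  let ?h = "inv_into ?T (terminal_of G)"
  have "inj ?h" using inj_on_inv_into[of UNIV "terminal_of G" ?T] im by simp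
  moreover have "expand ?R ?r = map ?h w"
  proof -
    have "map ?h w = map (\<lambda>i. ?h (terminal_of G i)) (expand ?R ?r)"
      by (subst s(1)[symmetric]) (simp add: comp_def)
    also have "\<dots> = expand ?R ?r" using inj by (intro map_idI) simp
    finally show ?thesis by simp
  qed
  moreover have "?h c < length G \<and> G ! ?h c = Term c" for c
  proof -
    have "?h c \<in> ?T" "terminal_of G (?h c) = c"
      using im by (simp_all add: inv_into_into f_inv_into_f)
    then show ?thesis using s(3) by metis
  qed
  ultimately show "\<exists>h. inj h \<and> expand ?R ?r = map h w \<and>
      card (binaries ?R ?r) \<le> Suc N \<and> (\<forall>c. h c < length G \<and> G ! h c = Term c)"
    using \<open>card (binaries ?R ?r) \<le> Suc N\<close> by blast
qed

lemma derivation_append: "derivation G i t \<Longrightarrow> derivation (G @ H) i t"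
  by (induction rule: derivation.induct) (auto intro: derivation.intros simp: nth_append)

text \<open>The defining recursion, read as a grammar, attains the bound. The trees of two
  consecutive words are carried along because the next production refers to both.\<close>

lemma fib_grammar_exists:
  "\<exists>G. length G = Suc (Suc m) \<and> wf_slp G \<and>
     (\<exists>t u. derivation G (Suc m) t \<and> yield t = fib_word (Suc (Suc m)) \<and>
       derivation G m u \<and> yield u = fib_word (Suc m))"
proof (induction m)
  case 0
  let ?G = "[Term Lb, Term La] :: letter slp"
  have "derivation ?G 1 (Leaf 1 La)" "derivation ?G 0 (Leaf 0 Lb)"
    by (auto intro: derivation.intros)
  moreover have "wf_slp ?G" by (auto simp: wf_slp_def nth_Cons split: nat.splits)
  ultimately show ?case by (intro exI[of _ ?G]) force
next
  case (Suc m)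
  then obtain G t u where G: "length G = Suc (Suc m)" "wf_slp G"
    "derivation G (Suc m) t" "yield t = fib_word (Suc (Suc m))"
    "derivation G m u" "yield u = fib_word (Suc m)" by blast
  let ?H = "G @ [Bin (Suc m) m]"
  have "derivation ?H (Suc (Suc m)) (Node (Suc (Suc m)) t u)"
    by (rule derivation.intros) (use G derivation_append in \<open>auto simp: nth_append\<close>)
  moreover have "yield (Node (Suc (Suc m)) t u) = fib_word (Suc (Suc (Suc m)))"
    using G by simp
  moreover have "derivation ?H (Suc m) t" using derivation_append G by blast
  moreover have "wf_slp ?H" using G(1,2) by (auto simp: wf_slp_def nth_append less_Suc_eq)
  ultimately show ?case using G by (intro exI[of _ ?H]) (metis length_append_singleton)
qed

section \<open>Outputs of RePair are grammars\<close>

inductive generates :: "'t slp \<Rightarrow> nat list \<Rightarrow> 't list \<Rightarrow> bool" for G where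
  "generates G [] []"
| "derivation G i t \<Longrightarrow> generates G s v \<Longrightarrow> generates G (i # s) (yield t @ v)"

lemma generates_Cons_iff:
  "generates G (i # s) w \<longleftrightarrow> (\<exists>t v. derivation G i t \<and> generates G s v \<and> w = yield t @ v)"
  by (subst generates.simps) auto

lemma generates_append: "generates G s v \<Longrightarrow> generates (G @ H) s v"
  by (induction rule: generates.induct) (auto intro: generates.intros derivation_append)

lemma derivation_less: "derivation G i t \<Longrightarrow> i < length G"
  by (auto elim: derivation.cases)

lemma generates_less: "generates G s v \<Longrightarrow> set s \<subseteq> {..<length G}"
  by (induction rule: generates.induct) (auto dest: derivation_less)

lemma generates_fold:
  assumes "generates G (x # y # s) v"
  obtains t v' where "derivation (G @ [Bin x y]) (length G) t" "generates G s v'" "v = yield t @ v'"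
proof -
  obtain l r v' where *: "derivation G x l" "derivation G y r" "generates G s v'"
    "v = yield l @ yield r @ v'"
    using assms by (auto simp: generates_Cons_iff)
  have "derivation (G @ [Bin x y]) (length G) (Node (length G) l r)"
    by (rule derivation.intros) (use * derivation_append in auto)
  then show ?thesis using that[OF _ *(3)] *(4) by simp
qed

lemma generates_replace:
  "generates G s v \<Longrightarrow> generates (G @ [Bin x y]) (replace_bigram x y (length G) s) v"
proof (induction x y "length G" s arbitrary: v rule: replace_bigram.induct)
  case (1 x y u w s)
  show ?case
  proof (cases "u = x \<and> w = y")
    case True
    then obtain t v' where "derivation (G @ [Bin x y]) (length G) t" "generates G s v'" "v = yield t @ v'"
      using 1(3) generates_fold by blast
    then show ?thesis using True 1(1) by (auto simp: generates_Cons_iff)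
  next
    case False
    obtain t v' where "derivation G u t" "generates G (w # s) v'" "v = yield t @ v'"
      using 1(3) by (subst (asm) generates_Cons_iff) blast
    then show ?thesis using False 1(2)[OF False] derivation_append
      by (auto intro!: generates.intros(2) simp del: replace_bigram.simps(1) simp: replace_bigram.simps(1)[of x y _ u w s] )
  qed
qed (simp_all add: generates_append)

lemma generates_combine:
  "generates G (s1 @ x # y # s2) v \<Longrightarrow> generates (G @ [Bin x y]) (s1 @ length G # s2) v"
proof (induction s1 arbitrary: v)
  case Nil
  then obtain t v' where "derivation (G @ [Bin x y]) (length G) t" "generates G s2 v'" "v = yield t @ v'"
    using generates_fold by (metis append_Nil)
  then show ?case using generates.intros(2) generates_append by fastforce
next
  case (Cons a s1)
  from Cons(2) obtain t v' where *: "derivation G a t" "generates G (s1 @ x # y # s2) v'" "v = yield t @ v'"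
    by (auto simp: generates_Cons_iff)
  show ?case using generates.intros(2)[OF derivation_append[OF *(1)] Cons(1)[OF *(2)]] *(3) by simp
qed

definition valid_state :: "'t list \<Rightarrow> 't repair_state \<Rightarrow> bool" where
  "valid_state w \<sigma> \<longleftrightarrow> (\<forall>i < length (fst \<sigma>). \<forall>j k. fst \<sigma> ! i = Bin j k \<longrightarrow> j < i \<and> k < i) \<and>
     generates (fst \<sigma>) (snd \<sigma>) w"

lemma valid_state_extend:
  assumes "valid_state w (G, s)" "x \<in> set s" "y \<in> set s" "generates (G @ [Bin x y]) s' w"
  shows "valid_state w (G @ [Bin x y], s')"
  using assms generates_less[of G s w]
  by (auto simp: valid_state_def nth_append less_Suc_eq)

lemma repair_init_valid:
  assumes "repair_init w \<sigma>"
  shows "valid_state w \<sigma>"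
  using assms
proof cases
  case (1 cs s)
  have "generates (map Term cs) s (map ((!) cs) s)" if "set s \<subseteq> {..<length cs}" for s
    using that
  proof (induction s)
    case (Cons i s)
    then have "derivation (map Term cs) i (Leaf i (cs ! i))" by (auto intro: derivation.intros)
    then show ?case using Cons generates.intros(2) by fastforce
  qed (auto intro: generates.intros)
  then show ?thesis using 1 by (auto simp: valid_state_def)
qed

lemma repair_step_valid: "repair_step \<sigma> \<sigma>' \<Longrightarrow> valid_state w \<sigma> \<Longrightarrow> valid_state w \<sigma>'"
proof (induction rule: repair_step.induct)
  case (1 s x y G)
  then have "x \<in> set s \<and> y \<in> set s" using bigram_freq_posD[of s x y] by simp
  then show ?case using 1 generates_replace by (intro valid_state_extend) (auto simp: valid_state_def)
qed

lemma combine_step_valid: "combine_step \<sigma> \<sigma>' \<Longrightarrow> valid_state w \<sigma> \<Longrightarrow> valid_state w \<sigma>'"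
proof (induction rule: combine_step.induct)
  case (1 G s1 x y s2)
  then show ?case using generates_combine by (intro valid_state_extend[where s = "s1 @ x # y # s2"]) (auto simp: valid_state_def)
qed

lemma combine_steps_length:
  "combine_step\<^sup>*\<^sup>* \<sigma> \<sigma>' \<Longrightarrow> length (fst \<sigma>') + length (snd \<sigma>') = length (fst \<sigma>) + length (snd \<sigma>)"
  by (induction rule: rtranclp_induct) (auto elim!: combine_step.cases)

lemma combine_steps_start:
  assumes "combine_step\<^sup>*\<^sup>* (G1, s1) (G, [x])" "length s1 \<ge> 2"
  shows "x = start G"
  using assms(1)
proof (cases rule: rtranclp.cases)
  case (rtrancl_into_rtrancl \<sigma>)
  from rtrancl_into_rtrancl(2) show ?thesis
    by cases (auto simp: start_def Cons_eq_append_conv append_eq_Cons_conv)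
qed (use assms in auto)

lemma valid_rtranclp:
  assumes "R\<^sup>*\<^sup>* \<sigma> \<sigma>'" "\<And>\<sigma> \<sigma>'. R \<sigma> \<sigma>' \<Longrightarrow> P \<sigma> \<Longrightarrow> P \<sigma>'" "P \<sigma>"
  shows "P \<sigma>'"
  using assms by (induction rule: rtranclp_induct) auto

text \<open>An invariant of every run, however ties are broken. A replacement adds one production
  and lowers the index by one, so the sum is constant; its value comes from the two terminal rules
  at the start, where \<open>M = N\<close>.\<close>

definition fib_state :: "nat \<Rightarrow> 't repair_state \<Rightarrow> bool" where
  "fib_state N \<sigma> \<longleftrightarrow> (\<exists>M w g. fibw M w \<and> snd \<sigma> = map g w \<and> inj g \<and>
     (\<forall>c. g c < length (fst \<sigma>)) \<and> length (fst \<sigma>) + M = N + 2)"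

lemma repair_init_fib_state:
  assumes "repair_init w \<sigma>" "fibw N w"
  shows "fib_state N \<sigma>"
  using assms(1)
proof cases
  case (1 cs s)
  have "set cs = UNIV"
  proof -
    have "set w = (!) cs ` {..<length cs}" using 1 by (metis set_map)
    then show ?thesis using fibw_letters[OF assms(2)] by (auto simp: set_conv_nth)
  qed
  then have "length cs = 2" using 1 card_UNIV_letter distinct_card by metis
  have bij: "bij_betw ((!) cs) {..<length cs} UNIV"
    using bij_betw_nth[OF 1(2)] \<open>set cs = UNIV\<close> by simp
  let ?g = "inv_into {..<length cs} ((!) cs)"
  have "inj ?g" using bij bij_betw_inv_into bij_betw_imp_inj_on by blast
  moreover have "s = map ?g w"
  proof -
    have "map ?g w = map (\<lambda>i. ?g (cs ! i)) s" unfolding 1(4)[symmetric] by (simp add: comp_def)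
    also have "\<dots> = s" using bij 1(3) by (intro map_idI) (auto simp: bij_betw_def)
    finally show ?thesis by simp
  qed
  moreover have "?g c < length cs" for c
    using bij inv_into_into[of c "(!) cs" "{..<length cs}"] by (simp add: bij_betw_def)
  ultimately show ?thesis unfolding fib_state_def 1(1)
    using assms(2) \<open>length cs = 2\<close> by (intro exI[of _ N] exI[of _ w] exI[of _ ?g]) simp
qed

lemma max_bigram_map_iff:
  assumes "fibw N w" "N \<ge> 2" "inj g"
  shows "bigram_freq (map g w) x y \<ge> 2 \<and>
      (\<forall>x' y'. bigram_freq (map g w) x' y' \<le> bigram_freq (map g w) x y) \<longleftrightarrow>
    x = g La \<and> y = g Lb \<and> hd w = La \<or> x = g Lb \<and> y = g La \<and> last w = La"
    (is "?l \<longleftrightarrow> ?r")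
proof
  assume l: ?l
  then have "bigram_freq (map g w) x y > 0" by linarith
  from bigram_freq_posD[OF this] obtain c d where cd: "x = g c" "y = g d" by auto
  have "bigram_freq w c d \<ge> 2 \<and> (\<forall>c' d'. bigram_freq w c' d' \<le> bigram_freq w c d)"
  proof (intro conjI allI)
    show "bigram_freq w c d \<ge> 2" using l unfolding cd bigram_freq_map[OF assms(3)] by blast
    show "bigram_freq w c' d' \<le> bigram_freq w c d" for c' d'
      using l[THEN conjunct2, rule_format, of "g c'" "g d'"]
      unfolding cd bigram_freq_map[OF assms(3)] .
  qed
  then have "c = La \<and> d = Lb \<and> hd w = La \<or> c = Lb \<and> d = La \<and> last w = La"
    by (rule iffD1[OF fibw_max_bigram[OF assms(1,2)]])
  then show ?r using cd by auto
next
  assume ?r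
  then have "\<exists>c d. x = g c \<and> y = g d \<and> (c = La \<and> d = Lb \<and> hd w = La \<or> c = Lb \<and> d = La \<and> last w = La)"
    by auto
  then obtain c d where cd: "x = g c" "y = g d"
    and max: "c = La \<and> d = Lb \<and> hd w = La \<or> c = Lb \<and> d = La \<and> last w = La"
    by (elim exE conjE)
  from max have f: "bigram_freq w c d \<ge> 2 \<and> (\<forall>c' d'. bigram_freq w c' d' \<le> bigram_freq w c d)"
    by (intro iffD2[OF fibw_max_bigram[OF assms(1,2)]])
  have "bigram_freq (map g w) x' y' \<le> bigram_freq (map g w) x y" for x' y'
  proof (cases "bigram_freq (map g w) x' y' > 0")
    case True
    from bigram_freq_posD[OF True] obtain c' d' where cd': "x' = g c'" "y' = g d'" by auto
    show ?thesis unfolding cd cd' bigram_freq_map[OF assms(3)] using f by simp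
  qed simp
  then show ?l using f unfolding cd bigram_freq_map[OF assms(3)] by blast
qed

lemma repair_step_fib_state:
  assumes "repair_step \<sigma> \<sigma>'" "fib_state N \<sigma>"
  shows "fib_state N \<sigma>'"
  using assms(1)
proof cases
  case (1 s x y G)
  then obtain M w g where w: "fibw M w" "s = map g w" "inj g" "length G + M = N + 2"
      "\<And>c. g c < length G"
    using assms(2) by (auto simp: fib_state_def)
  \<comment> \<open>Words of index 0 and 1 have at most three letters, too few for two disjoint
    occurrences of a bigram.\<close>
  have M: "M \<ge> 2"
  proof (rule ccontr)
    assume "\<not> M \<ge> 2"
    then have "length (cen M) \<le> 1" using length_cen_mono[of M 1] by simp
    then have "length s \<le> 3" using w fibw_length by simp
    then show False using bigram_freq_short[of s x y] 1(3) by simp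
  qed
  then obtain M' where M': "M = Suc M'" by (cases M) auto
  have fresh: "length G \<noteq> g La" using w(5)[of La] by simp
  have inj: "inj (case_letter (length G) (g La))"
    using fresh by (auto simp: inj_def split: letter.splits)
  have "x = g La \<and> y = g Lb \<and> hd w = La \<or> x = g Lb \<and> y = g La \<and> last w = La"
    using max_bigram_map_iff[OF w(1) M w(3), of x y] 1(3,4) unfolding w(2) by blast
  then obtain w' where "fibw M' w'" "replace_bigram x y (length G) s = map (case_letter (length G) (g La)) w'"
    using fibw_phi[OF w(1)[unfolded M']] fibw_psi[OF w(1)[unfolded M']] replace_phi[OF w(3)]
      replace_psi[OF w(3)] w(2) by metis
  moreover have "case_letter (length G) (g La) c < Suc (length G)" for c
    using w(5)[of La] by (cases c) auto
  ultimately show ?thesis unfolding fib_state_def 1(2)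
    using w(4) M' inj by (intro exI[of _ M'] exI[of _ w'] exI[of _ "case_letter (length G) (g La)"]) simp
qed

section \<open>Every smallest grammar is an output of RePair\<close>

text \<open>
  Position \<open>i\<close> of the grammar \<open>H\<close> built by RePair is the non-terminal \<open>zs ! i\<close> of \<open>G\<close>.
\<close>

definition embeds :: "'t slp \<Rightarrow> nat list \<Rightarrow> 't slp \<Rightarrow> bool" where
  "embeds G zs H \<longleftrightarrow> distinct zs \<and> length zs = length H \<and> set zs \<subseteq> {..<length G} \<and>
     (\<forall>i < length H. case H ! i of Term c \<Rightarrow> G ! (zs ! i) = Term c
        | Bin j k \<Rightarrow> j < i \<and> k < i \<and> G ! (zs ! i) = Bin (zs ! j) (zs ! k))"

lemma embeds_append:
  assumes "embeds G zs H" "z \<notin> set zs" "rules_of G z = Some (zs ! x, zs ! y)"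
    and "x < length H" "y < length H"
  shows "embeds G (zs @ [z]) (H @ [Bin x y])"
proof -
  have z: "z < length G" "G ! z = Bin (zs ! x) (zs ! y)" using assms(3) by (auto simp: rules_of_Some)
  have "case (H @ [Bin x y]) ! i of Term c \<Rightarrow> G ! ((zs @ [z]) ! i) = Term c
        | Bin j k \<Rightarrow> j < i \<and> k < i \<and> G ! ((zs @ [z]) ! i) = Bin ((zs @ [z]) ! j) ((zs @ [z]) ! k)"
    if "i < length (H @ [Bin x y])" for i
  proof (cases "i < length H")
    case True
    then have "case H ! i of Term c \<Rightarrow> G ! (zs ! i) = Term c
        | Bin j k \<Rightarrow> j < i \<and> k < i \<and> G ! (zs ! i) = Bin (zs ! j) (zs ! k)"
      using assms(1) by (auto simp: embeds_def)
    then show ?thesis using True assms(1) by (auto simp: nth_append embeds_def split: rhs.splits)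
  next
    case False
    then have "i = length H" using that by simp
    then show ?thesis using z assms by (auto simp: nth_append embeds_def)
  qed
  then show ?thesis using assms z unfolding embeds_def by auto
qed

lemma embeds_derivation:
  assumes "embeds G zs H"
  shows "derivation H i t \<Longrightarrow> derivation G (zs ! i) (map_dtree ((!) zs) id t)"
proof (induction rule: derivation.induct)
  case (Leaf i c)
  then have "zs ! i < length G" using assms by (auto simp: embeds_def subset_iff)
  moreover have "G ! (zs ! i) = Term c" using assms Leaf by (force simp: embeds_def)
  ultimately show ?case by (auto intro: derivation.intros)
next
  case (Node i j k l r)
  then have "zs ! i < length G" using assms by (auto simp: embeds_def subset_iff)
  moreover have "G ! (zs ! i) = Bin (zs ! j) (zs ! k)" using assms Node(1,2) by (force simp: embeds_def)
  ultimately show ?case using Node by (auto intro: derivation.intros)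
qed

context acyclic_rules
begin

lemma expand_eq_1: "expand R r = [a] \<Longrightarrow> r = a"
  using len_eq_1[of r] expand_None[of r] by simp

lemma expand_eq_2:
  assumes "expand R r = [a, b]"
  shows "R r = Some (a, b)"
proof (cases "R r")
  case None
  then show ?thesis using assms expand_None[of r] by simp
next
  case (Some p)
  then obtain j k where jk: "R r = Some (j, k)" by (cases p) auto
  then have e: "expand R j @ expand R k = [a, b]" using assms expand_Some by simp
  then have "expand R j = [a] \<and> expand R k = [b]"
    by (auto simp: append_eq_Cons_conv)
  then show ?thesis using jk expand_eq_1 by blast
qed

lemma expand_eq_3:
  assumes "expand R r = [a, b, c]"
  obtains p where "R r = Some (p, c)" "R p = Some (a, b)"
  | p where "R r = Some (a, p)" "R p = Some (b, c)"
proof (cases "R r")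
  case None
  then show ?thesis using assms expand_None[of r] by simp
next
  case (Some p)
  then obtain j k where jk: "R r = Some (j, k)" by (cases p) auto
  then have e: "expand R j @ expand R k = [a, b, c]" using assms expand_Some by simp
  then have "expand R j = [a] \<and> expand R k = [b, c] \<or> expand R j = [a, b] \<and> expand R k = [c]"
    by (auto simp: append_eq_Cons_conv)
  then show ?thesis using jk expand_eq_1 expand_eq_2 that by blast
qed

end

lemma embeds_distinct_nth:
  "embeds G zs H \<Longrightarrow> i < length H \<Longrightarrow> j < length H \<Longrightarrow> zs ! i = zs ! j \<longleftrightarrow> i = j"
  by (auto simp: embeds_def nth_eq_iff_index_eq)

lemma fibw_short:
  assumes "fibw N w" "N \<le> 1"
  shows "length w = N + 2"
  using assms fibw_length[OF assms(1)] by (cases N) auto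

text \<open>RePair is replayed inside \<open>G\<close>: \<open>zs\<close> lists the non-terminals
  already created, and \<open>R\<close> is what remains of the rules of \<open>G\<close> when these
  count as letters. Contracting the rule from \<open>fibw_bigram_rule\<close> lowers both the number
  of binary rules and the index by one, so the extremal bound holds again for the shorter
  word.\<close>

lemma fibw_repair_run:
  assumes "acyclic_rules R" "embeds G zs H"
    and "\<And>i. i \<in> set zs \<Longrightarrow> R i = None" "\<And>i. i \<notin> set zs \<Longrightarrow> R i = rules_of G i"
    and "inj g" "\<And>c. g c < length H" "expand R r = map (\<lambda>c. zs ! g c) w" "fibw N w"
    and "card (binaries R r) \<le> Suc N"
  shows "\<exists>H1 s1 zs' H' x. repair_step\<^sup>*\<^sup>* (H, map g w) (H1, s1) \<and> (\<forall>x y. bigram_freq s1 x y < 2) \<and>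
    combine_step\<^sup>*\<^sup>* (H1, s1) (H', [x]) \<and> embeds G zs' H' \<and> Suc x = length H' \<and> zs' ! x = r \<and>
    length H' = length H + Suc N"
  using assms
proof (induction N arbitrary: R zs H g w rule: less_induct)
  case (less N)
  interpret acyclic_rules R by (rule less.prems(1))
  note emb = less.prems(2)
  have len: "length zs = length H" using emb by (simp add: embeds_def)
  have new: "i \<notin> set zs \<and> rules_of G i = Some (j, k)" if "R i = Some (j, k)" for i j k
  proof -
    have "i \<notin> set zs" using that less.prems(3) by fastforce
    then show ?thesis using that less.prems(4) by metis
  qed
  consider "N = 0" | "N = 1" | "N \<ge> 2" by linarith
  then show ?case
  proof cases
    case 1
    then have "length w = Suc (Suc 0)" using fibw_short[OF less.prems(8)] by simp
    then obtain c d where w: "w = [c, d]" by (auto simp: length_Suc_conv)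
    have r: "R r = Some (zs ! g c, zs ! g d)" using expand_eq_2 less.prems(7) w by simp
    let ?H' = "H @ [Bin (g c) (g d)]"
    have "embeds G (zs @ [r]) ?H'"
      using embeds_append[OF emb] new[OF r] less.prems(6) by blast
    moreover have "combine_step (H, map g w) (?H', [length H])"
      using combine_step.intros[of H "[]" "g c" "g d" "[]"] w by simp
    moreover have "\<forall>x y. bigram_freq (map g w) x y < 2"
      using bigram_freq_short[of "map g w"] w by simp
    ultimately show ?thesis using 1 len
      by (intro exI[of _ H] exI[of _ "map g w"] exI[of _ "zs @ [r]"] exI[of _ ?H'] exI[of _ "length H"])
        (auto simp: nth_append)
  next
    case 2
    then have "length w = Suc (Suc (Suc 0))" using fibw_short[OF less.prems(8)] by simp
    then obtain c d e where w: "w = [c, d, e]" by (auto simp: length_Suc_conv)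
    have short: "\<forall>x y. bigram_freq (map g w) x y < 2"
      using bigram_freq_short[of "map g w"] w by simp
    \<comment> \<open>Both bracketings of three symbols are handled at once: \<open>p\<close>
      combines the first chosen pair and \<open>r\<close> joins \<open>p\<close> with the remaining
      symbol.\<close>
    have fold: ?thesis if p: "R p = Some (zs ! x, zs ! y)" and r: "R r = Some ((zs @ [p]) ! x', (zs @ [p]) ! y')"
      and lt: "x < length H" "y < length H" "x' < Suc (length H)" "y' < Suc (length H)"
      and pr: "p < r"
      and steps: "combine_step (H, map g w) (H @ [Bin x y], [x', y'])" for p x y x' y'
    proof -
      let ?H1 = "H @ [Bin x y]"
      let ?H' = "?H1 @ [Bin x' y']"
      have 1: "embeds G (zs @ [p]) ?H1" using embeds_append[OF emb] new[OF p] lt by blast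
      have 2: "embeds G ((zs @ [p]) @ [r]) ?H'"
        by (rule embeds_append[OF 1]) (use new[OF r] lt pr in auto)
      have "combine_step (?H1, [x', y']) (?H', [length ?H1])"
        using combine_step.intros[of ?H1 "[]" x' y' "[]"] by simp
      then have "combine_step\<^sup>*\<^sup>* (H, map g w) (?H', [length ?H1])" using steps by simp
      then show ?thesis using short \<open>N = 1\<close> len 2
        by (intro exI[of _ H] exI[of _ "map g w"] exI[of _ "(zs @ [p]) @ [r]"] exI[of _ ?H'] exI[of _ "length ?H1"])
          (auto simp: nth_append)
    qed
    have "expand R r = [zs ! g c, zs ! g d, zs ! g e]" using less.prems(7) w by simp
    then show ?thesis
    proof (cases rule: expand_eq_3)
      case (1 p)
      show ?thesis
      proof (rule fold[of p "g c" "g d" "length H" "g e"])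
        show "combine_step (H, map g w) (H @ [Bin (g c) (g d)], [length H, g e])"
          using combine_step.intros[of H "[]" "g c" "g d" "[g e]"] w by simp
        show "R r = Some ((zs @ [p]) ! length H, (zs @ [p]) ! g e)"
          using 1 len less.prems(6)[of e] by (simp add: nth_append)
      qed (use 1 less.prems(6) acyclic less_Suc_eq in auto)
    next
      case (2 p)
      show ?thesis
      proof (rule fold[of p "g d" "g e" "g c" "length H"])
        show "combine_step (H, map g w) (H @ [Bin (g d) (g e)], [g c, length H])"
          using combine_step.intros[of H "[g c]" "g d" "g e" "[]"] w by simp
        show "R r = Some ((zs @ [p]) ! g c, (zs @ [p]) ! length H)"
          using 2 len less.prems(6)[of c] by (simp add: nth_append)
      qed (use 2 less.prems(6) acyclic less_Suc_eq in auto)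
    qed
  next
    case 3
    then obtain M where M: "N = Suc M" by (cases N) auto
    define h where "h = (\<lambda>c. zs ! g c)"
    have inj: "inj h"
      unfolding h_def by (rule injI) (use embeds_distinct_nth[OF emb] less.prems(5,6) in \<open>auto dest: injD\<close>)
    have exp: "expand R r = map h w" using less.prems(7) by (simp add: h_def)
    obtain Z where Z: "Z \<in> binaries R r" "R Z = Some (h La, h Lb) \<or> R Z = Some (h Lb, h La)"
      "\<And>X j k. X \<in> binaries R r \<Longrightarrow> R X = Some (j, k) \<Longrightarrow> j = h Lb \<or> k = h Lb \<Longrightarrow> X = Z"
      using fibw_bigram_rule[OF exp less.prems(8) 3 inj less.prems(9)] by blast
    then obtain c d where cd: "R Z = Some (h c, h d)" "c = La \<and> d = Lb \<or> c = Lb \<and> d = La" by blast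
    then have UNIV: "{c, d} = UNIV" using letter.exhaust by auto
    have "length w \<ge> 2" using fibw_length[OF less.prems(8)] by simp
    have Rr: "R r \<noteq> None"
    proof
      assume "R r = None"
      then have "len R r = 1" by (simp add: expand_None)
      then show False using exp \<open>length w \<ge> 2\<close> by simp
    qed
    obtain v where v: "expand (R(Z := None)) r = map (case_letter Z (h La)) v"
      "w = concat (map (case_letter [c, d] [La]) v)"
    proof (rule contract_bigram[OF exp inj Rr fibw_letters[OF less.prems(8)] cd(1) UNIV])
      show "X = Z" if "X \<in> binaries R r" "R X = Some (j, k)" "j = h Lb \<or> k = h Lb" for X j k
        by (rule Z(3)[OF that])
    qed (rule that)
    let ?g = "case_letter (length H) (g La)"
    have wne: "w \<noteq> []" using \<open>length w \<ge> 2\<close> by auto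
    have step: "c = La \<and> d = Lb \<and> hd w = La \<or> c = Lb \<and> d = La \<and> last w = La"
      "fibw M v" "replace_bigram (g c) (g d) (length H) (map g w) = map ?g v"
    proof -
      have "(c = La \<and> d = Lb \<and> hd w = La \<or> c = Lb \<and> d = La \<and> last w = La) \<and>
        fibw M v \<and> replace_bigram (g c) (g d) (length H) (map g w) = map ?g v"
        using cd(2)
      proof (elim disjE conjE)
        assume cd: "c = La" "d = Lb"
        then have w: "w = phi v" using v(2) phi_concat by simp
        then have hd: "hd w = La" using phi_hd[of v] wne by auto
        then obtain w' where "fibw M w'" "w = phi w'"
          using fibw_phi[of M w] less.prems(8) M by blast
        then have "fibw M v" using phi_inj w by blast
        then show ?thesis using cd hd w replace_phi[OF less.prems(5)] by simp
      next
        assume cd: "c = Lb" "d = La"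
        then have w: "w = psi v" using v(2) psi_concat by simp
        have "last (psi v) = La" if "psi v \<noteq> []" for v
          using that by (induction v rule: psi.induct) auto
        then have last: "last w = La" using wne w by blast
        then obtain w' where "fibw M w'" "w = psi w'"
          using fibw_psi[of M w] less.prems(8) M by blast
        then have "fibw M v" using psi_inj w by blast
        then show ?thesis using cd last w replace_psi[OF less.prems(5)] by simp
      qed
      then show "c = La \<and> d = Lb \<and> hd w = La \<or> c = Lb \<and> d = La \<and> last w = La"
        "fibw M v" "replace_bigram (g c) (g d) (length H) (map g w) = map ?g v" by blast+
    qed
    let ?H = "H @ [Bin (g c) (g d)]" and ?R = "R(Z := None)" and ?zs = "zs @ [Z]"
    have "g c = g La \<and> g d = g Lb \<and> hd w = La \<or> g c = g Lb \<and> g d = g La \<and> last w = La"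
      using step(1) by auto
    then have "bigram_freq (map g w) (g c) (g d) \<ge> 2 \<and>
      (\<forall>x' y'. bigram_freq (map g w) x' y' \<le> bigram_freq (map g w) (g c) (g d))"
      by (intro iffD2[OF max_bigram_map_iff[OF less.prems(8) 3 less.prems(5)]])
    then have repair: "repair_step (H, map g w) (?H, map ?g v)"
      using repair_step.intros[of "map g w" "g c" "g d" H] step(3) by simp
    have Znew: "Z \<notin> set zs" "rules_of G Z = Some (zs ! g c, zs ! g d)"
      using new[OF cd(1)] by (simp_all add: h_def)
    have "\<exists>H1 s1 zs' H' x. repair_step\<^sup>*\<^sup>* (?H, map ?g v) (H1, s1) \<and> (\<forall>x y. bigram_freq s1 x y < 2) \<and>
      combine_step\<^sup>*\<^sup>* (H1, s1) (H', [x]) \<and> embeds G zs' H' \<and> Suc x = length H' \<and> zs' ! x = r \<and>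
      length H' = length ?H + Suc M"
    proof (rule less.IH[of M ?R ?zs ?H ?g v])
      show "M < N" using M by simp
      show "acyclic_rules ?R" by (rule acyclic_contract)
      show "embeds G ?zs ?H" using embeds_append[OF emb Znew] less.prems(6) by blast
      show "?R i = None" if "i \<in> set ?zs" for i using that less.prems(3) by auto
      show "?R i = rules_of G i" if "i \<notin> set ?zs" for i using that less.prems(4) by auto
      show "inj ?g" using less.prems(6)[of La] by (auto simp: inj_def split: letter.splits)
      show "?g c < length ?H" for c using less.prems(6)[of La] by (cases c) auto
      have "(\<lambda>c. ?zs ! ?g c) = case_letter Z (h La)"
        using len less.prems(6)[of La] by (auto simp: h_def nth_append fun_eq_iff split: letter.splits)
      then show "expand ?R r = map (\<lambda>c. ?zs ! ?g c) v" using v(1) by simp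
      show "fibw M v" by (rule step(2))
      have "card (binaries ?R r) \<le> card (binaries R r - {Z})"
        by (rule card_mono) (use binaries_contract in auto)
      also have "\<dots> = card (binaries R r) - 1" using Z(1) by simp
      finally show "card (binaries ?R r) \<le> Suc M" using less.prems(9) M by simp
    qed
    then obtain H1 s1 zs' H' x where *: "repair_step\<^sup>*\<^sup>* (?H, map ?g v) (H1, s1)" "\<forall>x y. bigram_freq s1 x y < 2"
      "combine_step\<^sup>*\<^sup>* (H1, s1) (H', [x])" "embeds G zs' H'" "Suc x = length H'" "zs' ! x = r"
      "length H' = length ?H + Suc M" by blast
    have "repair_step\<^sup>*\<^sup>* (H, map g w) (H1, s1)"
      using repair *(1) by (rule converse_rtranclp_into_rtranclp)
    then show ?thesis using * M by fastforce
  qed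
qed

lemma repair_output_fibw:
  assumes out: "repair_output w G" and w: "fibw N w"
  shows "grammar_of w G \<and> length G = N + 3"
proof -
  obtain \<sigma>0 G1 s1 x where r: "repair_init w \<sigma>0" "repair_step\<^sup>*\<^sup>* \<sigma>0 (G1, s1)"
    "\<forall>x y. bigram_freq s1 x y < 2" "combine_step\<^sup>*\<^sup>* (G1, s1) (G, [x])"
    using out by (auto simp: repair_output_def)
  have "valid_state w (G1, s1)"
    using valid_rtranclp[OF r(2), of "valid_state w"] repair_step_valid repair_init_valid[OF r(1)] by blast
  then have valid: "valid_state w (G, [x])"
    using valid_rtranclp[OF r(4), of "valid_state w"] combine_step_valid by blast
  have "fib_state N (G1, s1)"
    using valid_rtranclp[OF r(2), of "fib_state N"] repair_step_fib_state repair_init_fib_state[OF r(1) w] by blast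
  then obtain M v g where M: "fibw M v" "s1 = map g v" "inj g" "length G1 + M = N + 2"
    by (auto simp: fib_state_def)
  \<comment> \<open>At a larger index some bigram would still have frequency at least two, and the
    replacement phase would not be over.\<close>
  have "M \<le> 1"
  proof (rule ccontr)
    assume "\<not> M \<le> 1"
    then have M2: "M \<ge> 2" by simp
    obtain M' where "M = Suc M'" using M2 by (cases M) auto
    then have "hd v = La \<or> last v = La" using fibw_ends M(1) by blast
    then obtain c d where "c = La \<and> d = Lb \<and> hd v = La \<or> c = Lb \<and> d = La \<and> last v = La" by blast
    then have "bigram_freq v c d \<ge> 2" using iffD2[OF fibw_max_bigram[OF M(1) M2]] by blast
    then show False using r(3) bigram_freq_map[OF M(3), of v c d] M(2) by (metis not_less)
  qed
  then have l: "length s1 = M + 2" using fibw_short[OF M(1)] M(2) by simp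
  \<comment> \<open>A combination trades one symbol for one production. With \<open>M + 2\<close>
    symbols left, the unknown \<open>M\<close> cancels against the size of \<open>G1\<close>, so all
    outputs have the same size.\<close>
  have "length G + 1 = length G1 + length s1" using combine_steps_length[OF r(4)] by simp
  then have "length G = N + 3" using M(4) l by simp
  moreover have "x = start G" using combine_steps_start[OF r(4)] l by simp
  ultimately show ?thesis using valid
    by (auto simp: valid_state_def grammar_of_def wf_slp_def generates_Cons_iff elim: generates.cases)
qed

lemma smallest_grammar_repair:
  assumes G: "grammar_of w G" and w: "fibw N w" and small: "length G \<le> N + 3"
  shows "\<exists>H. repair_output w H \<and> (H, G) \<in> grammar_equiv w"
proof -
  have wf: "wf_slp G" using G by (simp add: grammar_of_def)
  obtain h where h: "inj h" "expand (rules_of G) (start G) = map h w"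
    "card (binaries (rules_of G) (start G)) \<le> Suc N" "\<And>c. h c < length G" "\<And>c. G ! h c = Term c"
    using fibw_grammar_size(2)[OF G w small] by blast
  let ?H0 = "map Term [La, Lb]" and ?zs0 = "[h La, h Lb]" and ?g = "case_letter 0 1 :: letter \<Rightarrow> nat"
  have zsg: "?zs0 ! ?g c = h c" for c by (cases c) auto
  have "\<exists>H1 s1 zs' H' x. repair_step\<^sup>*\<^sup>* (?H0, map ?g w) (H1, s1) \<and> (\<forall>x y. bigram_freq s1 x y < 2) \<and>
      combine_step\<^sup>*\<^sup>* (H1, s1) (H', [x]) \<and> embeds G zs' H' \<and> Suc x = length H' \<and> zs' ! x = start G \<and>
      length H' = length ?H0 + Suc N"
  proof (rule fibw_repair_run[of "rules_of G" G ?zs0])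
    show "embeds G ?zs0 ?H0"
      using h(4,5) injD[OF h(1), of La Lb] by (auto simp: embeds_def less_Suc_eq numeral_2_eq_2)
    show "inj ?g" by (auto simp: inj_def split: letter.splits)
    show "?g c < length ?H0" for c by (cases c) auto
    show "rules_of G i = None" if "i \<in> set ?zs0" for i using that h(5) by (auto simp: rules_of_def)
    show "expand (rules_of G) (start G) = map (\<lambda>c. ?zs0 ! ?g c) w" unfolding zsg by (rule h(2))
  qed (use acyclic_rules_of[OF wf] w h(3) in auto)
  then obtain H1 s1 zs H x where r: "repair_step\<^sup>*\<^sup>* (?H0, map ?g w) (H1, s1)"
    "\<forall>x y. bigram_freq s1 x y < 2" "combine_step\<^sup>*\<^sup>* (H1, s1) (H, [x])" "embeds G zs H"
    "Suc x = length H" "zs ! x = start G" "length H = N + 3" by auto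
  have "repair_init w (?H0, map ?g w)"
  proof (rule repair_init.intros)
    have "set (map ?g w) = range ?g" unfolding set_map fibw_letters[OF w] ..
    also have "\<dots> = ?g ` {La, Lb}" using letter.exhaust by (intro arg_cong[of _ _ "image ?g"]) auto
    also have "\<dots> = {..<length [La, Lb]}" by auto
    finally show "set (map ?g w) = {..<length [La, Lb]}" .
    have "[La, Lb] ! ?g c = c" for c by (cases c) auto
    then have "map (\<lambda>c. [La, Lb] ! ?g c) w = w" by (intro map_idI)
    then show "map ((!) [La, Lb]) (map ?g w) = w" by (simp only: map_map comp_def)
  qed simp
  then have out: "repair_output w H" using r unfolding repair_output_def by blast
  then have H: "grammar_of w H" using repair_output_fibw w by blast
  then obtain t where t: "derivation H (start H) t" by (auto simp: grammar_of_def)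
  have "start H = x" using r(5) by (simp add: start_def)
  then have "derivation G (start G) (map_dtree ((!) zs) id t)"
    using embeds_derivation[OF r(4) t] r(6) by simp
  \<comment> \<open>The reconstruction only embeds \<open>H\<close> into \<open>G\<close>. Equality
    of sizes makes \<open>zs\<close> exhaust the non-terminals of \<open>G\<close>, as the
    equivalence of grammars demands.\<close>
  moreover have "bij_betw ((!) zs) {..<length H} {..<length G}"
  proof -
    have zs: "distinct zs" "length zs = length H" "set zs \<subseteq> {..<length G}"
      using r(4) by (auto simp: embeds_def)
    have "set zs = {..<length G}"
      by (rule card_subset_eq) (use zs distinct_card[OF zs(1)] r(7) small card_mono[OF _ zs(3)] in auto)
    then show ?thesis using bij_betw_nth[OF zs(1)] zs(2) by simp
  qed
  ultimately show ?thesis using out grammar_equivI[OF H G _ t] by blast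
qed

section \<open>Words of a single letter\<close>

lemma grammar_of_single: "is_arg_min length (grammar_of [c]) G \<longleftrightarrow> G = [Term c]"
proof -
  have g: "grammar_of [c] [Term c]"
    unfolding grammar_of_def by (auto simp: wf_slp_def start_def intro!: exI[of _ "Leaf 0 c"] derivation.intros)
  have "G = [Term c]" if G: "grammar_of [c] G" "length G \<le> 1" for G
  proof -
    obtain a where a: "G = [a]" using G by (cases G) (auto simp: grammar_of_def wf_slp_def)
    obtain t where t: "derivation G 0 t" "yield t = [c]" using G a by (auto simp: grammar_of_def start_def)
    have "\<forall>j k. a \<noteq> Bin j k" using G a by (auto simp: grammar_of_def wf_slp_def)
    with t(1) show ?thesis using t(2) a by cases auto
  qed
  moreover have "length G \<ge> 1" if "grammar_of w G" for w and G :: "'a slp"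
    using that by (cases G) (auto simp: grammar_of_def wf_slp_def)
  moreover have "length [Term c] = 1" by simp
  ultimately show ?thesis using g unfolding is_arg_min_def by (metis leI not_less)
qed

lemma repair_output_single: "repair_output [c] G \<longleftrightarrow> G = [Term c]"
proof
  assume "repair_output [c] G"
  then obtain \<sigma>0 G1 s1 x where r: "repair_init [c] \<sigma>0" "repair_step\<^sup>*\<^sup>* \<sigma>0 (G1, s1)"
    "combine_step\<^sup>*\<^sup>* (G1, s1) (G, [x])" by (auto simp: repair_output_def)
  from r(1) have \<sigma>0: "\<sigma>0 = ([Term c], [0])"
  proof cases
    case (1 cs s)
    then obtain i where s: "s = [i]" "cs ! i = c" by (auto simp: map_eq_Cons_conv)
    then have set: "{..<length cs} = {i}" using 1 by simp
    have "card {..<length cs} = card {i}" unfolding set ..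
    then have l: "length cs = 1" by simp
    have "i < length cs" using set by blast
    obtain c' where "cs = [c']" using l by (auto simp: length_Suc_conv)
    then show ?thesis using 1(1) s l \<open>i < length cs\<close> by simp
  qed
  have "\<not> repair_step ([Term c], [0]) \<sigma>" for \<sigma>
    using bigram_freq_short[of "[0::nat]"] by (auto elim!: repair_step.cases simp: not_less[symmetric])
  then have "(G1, s1) = ([Term c], [0])" using r(2) unfolding \<sigma>0 by (metis converse_rtranclpE)
  moreover have "\<not> combine_step ([Term c], [0]) \<sigma>" for \<sigma> :: "'a repair_state"
    by (auto elim!: combine_step.cases simp: Cons_eq_append_conv)
  ultimately show "G = [Term c]" using r(3) by (metis converse_rtranclpE prod.inject)
next
  assume "G = [Term c]"
  moreover have "repair_init [c] (map Term [c], [0])" by (rule repair_init.intros) auto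
  moreover have "bigram_freq [0] x y < 2" for x y :: nat by (rule bigram_freq_short) simp
  ultimately show "repair_output [c] G" unfolding repair_output_def by fastforce
qed

theorem theorem2:
  fixes n :: nat
  assumes "n \<ge> 1"
  shows "Opt (fib_word n) = RePair (fib_word n)"
proof (cases "n \<le> 2")
  case True
  then have "n = Suc 0 \<or> n = Suc (Suc 0)" using assms by auto
  then obtain c where "fib_word n = [c]" by auto
  then show ?thesis by (simp add: Opt_def RePair_def grammar_of_single repair_output_single)
next
  case False
  then obtain N where N: "n = N + 3" by (metis add.commute le_Suc_ex not_less_eq_eq numeral_2_eq_2 numeral_3_eq_3)
  let ?w = "fib_word n"
  let ?E = "grammar_equiv ?w"
  let ?A = "{G. is_arg_min length (grammar_of ?w) G}" and ?B = "{G. repair_output ?w G}"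
  have w: "fibw N ?w" using fib_word_cen by (simp add: N fibw_def)
  obtain G0 where "grammar_of ?w G0" "length G0 = N + 3"
    using fib_grammar_exists[of "Suc N"] by (auto simp: N grammar_of_def start_def eval_nat_numeral)
  then have A: "G \<in> ?A \<longleftrightarrow> grammar_of ?w G \<and> length G \<le> N + 3" for G
    using fibw_grammar_size(1)[OF _ w] by (fastforce simp: is_arg_min_def not_less)
  have BA: "?B \<subseteq> ?A" using A repair_output_fibw[OF _ w] by auto
  \<comment> \<open>The reconstruction yields an output \<open>H\<close> equivalent to
    \<open>G\<close>, so the class of \<open>G\<close> is the class of an output. The converse
    inclusion already holds between the grammars themselves.\<close>
  have "?A // ?E \<subseteq> ?B // ?E"
  proof
    fix C assume "C \<in> ?A // ?E"
    then obtain G where G: "G \<in> ?A" "C = ?E `` {G}" by (auto elim: quotientE)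
    then obtain H where H: "repair_output ?w H" "(H, G) \<in> ?E"
      using smallest_grammar_repair[OF _ w] A by blast
    then have "?E `` {H} = C" using G(2) equiv_class_eq[OF equiv_grammar_equiv] by metis
    then show "C \<in> ?B // ?E" using H(1) by (auto intro: quotientI)
  qed
  moreover have "?B // ?E \<subseteq> ?A // ?E" using BA by (auto simp: quotient_def)
  ultimately show ?thesis by (auto simp: Opt_def RePair_def)
qed

end
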